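(* Fix $\alpha\in(1/2,1]$. Consider binary interval consensus on the star-shaped network of $n$ nodes, in which node $1$ is the hub, nodes $2,\dots,n$ are the leaves, and the contact rates are $q_{1,i}=q_{i,1}=1/(n-1)$ for $i=2,\dots,n$ and $q_{i,j}=0$ otherwise. Suppose that initially $\alpha n$ nodes are in state $0$ and $(1-\alpha)n$ nodes are in state $1$, and let $T_1$ be the first instant at which no node is in state $1$. Then the expected time to deplete the nodes in state $1$ satisfies, for large $n$ (with $\alpha n$ an integer), $$\mathbb{E}(T_1)=\frac{1}{(2\alpha-1)(3-2\alpha)}\,n\log(n)+O(n).$$
   Context: Binary interval consensus with contact rates $Q=(q_{i,j})$ on $V=\{1,\dots,n\}$ ($Q$ symmetric, non-negative, zero diagonal): each unordered pair of nodes $\{i,j\}$ gets in contact at the instances of a Poisson process of rate $q_{i,j}$, independently over pairs. At each time every node is in one of the four states $0,e_0,e_1,1$. When two nodes get in contact their states are updated as follows (first node, second node): $(0,1)\to(e_1,e_0)$; $(e_0,1)\to(1,e_1)$; $(e_1,0)\to(0,e_0)$; $(e_0,0)\to(0,e_0)$; $(e_1,1)\to(1,e_1)$; $(e_0,e_1)\to(e_1,e_0)$. For any other pair of states nothing changes.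
   Formalization: The case α = 1 is excluded (1/2 < α < 1 is assumed): for α = 1 no node is initially in state 1, so T_1 = 0 for every n, and the claimed n log(n) + O(n) is false. *)

theory Defs
  imports "HOL-Probability.Probability" "HOL-Library.Landau_Symbols"
begin

datatype opinion = St0 | Ste0 | Ste1 | St1

type_synonym config = "nat \<Rightarrow> opinion"

text \<open>The six update rules, each for one orientation (first node, second node) of the pair.\<close>

fun rule :: "opinion \<Rightarrow> opinion \<Rightarrow> (opinion \<times> opinion) option" where
  "rule St0 St1 = Some (Ste1, Ste0)"
| "rule Ste0 St1 = Some (St1, Ste1)"
| "rule Ste1 St0 = Some (St0, Ste0)"
| "rule Ste0 St0 = Some (St0, Ste0)"
| "rule Ste1 St1 = Some (St1, Ste1)"
| "rule Ste0 Ste1 = Some (Ste1, Ste0)"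
| "rule _ _ = None"

text \<open>Pairs of nodes are unordered, so a rule applies in whichever orientation matches; no
  rule matches a pair of states in both orientations.\<close>

definition interact :: "opinion \<Rightarrow> opinion \<Rightarrow> opinion \<times> opinion" where
  "interact a b =
     (case rule a b of Some (c, d) \<Rightarrow> (c, d)
      | None \<Rightarrow> (case rule b a of Some (d, c) \<Rightarrow> (c, d) | None \<Rightarrow> (a, b)))"

definition contact :: "nat \<Rightarrow> nat \<Rightarrow> config \<Rightarrow> config" where
  "contact i j x = x(i := fst (interact (x i) (x j)), j := snd (interact (x i) (x j)))"

definition contact_rates :: "nat \<Rightarrow> (nat \<Rightarrow> nat \<Rightarrow> real) \<Rightarrow> bool" where
  "contact_rates n Q \<longleftrightarrow>
     (\<forall>i\<in>{1..n}. Q i i = 0 \<and> (\<forall>j\<in>{1..n}. Q i j = Q j i \<and> 0 \<le> Q i j))"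

text \<open>An unordered pair of nodes is represented by its increasing enumeration.\<close>

definition node_pairs :: "nat \<Rightarrow> (nat \<times> nat) set" where
  "node_pairs n = {(i, j). i \<in> {1..n} \<and> j \<in> {1..n} \<and> i < j}"

text \<open>Counting process \<open>N\<close> of a Poisson process of rate \<open>q \<ge> 0\<close> on the half-line.  The
  Poisson probabilities are written out so that \<open>q = 0\<close> (no points) is included.  The
  subtraction is truncating, which is harmless since the paths are almost surely
  nondecreasing.  Repeated times in \<open>\<tau>\<close> are allowed, so finite sequences of times are
  covered.\<close>

definition poisson_process :: "'a measure \<Rightarrow> real \<Rightarrow> (real \<Rightarrow> 'a \<Rightarrow> nat) \<Rightarrow> bool" where
  "poisson_process M q N \<longleftrightarrow>
     (\<forall>t\<ge>0. N t \<in> measurable M (count_space UNIV)) \<and>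
     (AE \<omega> in M. N 0 \<omega> = 0 \<and> mono_on {0..} (\<lambda>t. N t \<omega>) \<and>
        (\<forall>t\<ge>0. continuous (at_right t) (\<lambda>s. real (N s \<omega>)))) \<and>
     (\<forall>\<tau>. 0 \<le> \<tau> 0 \<and> incseq \<tau> \<longrightarrow>
        prob_space.indep_vars M (\<lambda>_. count_space UNIV)
          (\<lambda>k \<omega>. N (\<tau> (Suc k)) \<omega> - N (\<tau> k) \<omega>) (UNIV :: nat set)) \<and>
     (\<forall>s t k. 0 \<le> s \<and> s < t \<longrightarrow>
        measure M {\<omega> \<in> space M. N t \<omega> - N s \<omega> = k} =
          exp (- (q * (t - s))) * (q * (t - s)) ^ k / fact k)"

text \<open>The path \<open>x\<close> starts at \<open>x0\<close> and is driven by the contacts counted by \<open>N\<close>: it does not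
  change over \<open>(s, t]\<close> if there is no contact in \<open>(s, t]\<close>, and undergoes the corresponding
  update if there is precisely one.  Almost surely contacts are isolated and no two of
  them are simultaneous, so this determines \<open>x\<close> on the half-line.\<close>

definition consensus_path ::
    "nat \<Rightarrow> config \<Rightarrow> (nat \<times> nat \<Rightarrow> real \<Rightarrow> nat) \<Rightarrow> (real \<Rightarrow> config) \<Rightarrow> bool" where
  "consensus_path n x0 N x \<longleftrightarrow>
     x 0 = x0 \<and>
     (\<forall>s t. 0 \<le> s \<and> s < t \<longrightarrow>
        ((\<forall>e\<in>node_pairs n. N e t = N e s) \<longrightarrow> x t = x s) \<and>
        (\<forall>(i, j)\<in>node_pairs n.
           N (i, j) t = N (i, j) s + 1 \<and>
           (\<forall>e\<in>node_pairs n - {(i, j)}. N e t = N e s) \<longrightarrow> x t = contact i j (x s)))"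

text \<open>Independence over pairs is independence of the whole processes, as random elements
  of the space of functions on the half-line.\<close>

definition interval_consensus ::
    "'a measure \<Rightarrow> nat \<Rightarrow> (nat \<Rightarrow> nat \<Rightarrow> real) \<Rightarrow> config \<Rightarrow>
     (nat \<times> nat \<Rightarrow> real \<Rightarrow> 'a \<Rightarrow> nat) \<Rightarrow> (real \<Rightarrow> 'a \<Rightarrow> config) \<Rightarrow> bool" where
  "interval_consensus M n Q x0 N X \<longleftrightarrow>
     prob_space M \<and> contact_rates n Q \<and>
     (\<forall>(i, j)\<in>node_pairs n. poisson_process M (Q i j) (N (i, j))) \<and>
     prob_space.indep_vars M (\<lambda>_. PiM {0..} (\<lambda>_. count_space UNIV))
       (\<lambda>e \<omega>. \<lambda>t\<in>{0..}. N e t \<omega>) (node_pairs n) \<and>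
     (\<forall>t\<ge>0. \<forall>i\<in>{1..n}. (\<lambda>\<omega>. X t \<omega> i) \<in> measurable M (count_space UNIV)) \<and>
     (AE \<omega> in M. consensus_path n x0 (\<lambda>e t. N e t \<omega>) (\<lambda>t. X t \<omega>))"

text \<open>The value is \<open>\<infinity>\<close> if the nodes in state 1 are never depleted.\<close>

definition depletion_time :: "nat \<Rightarrow> (real \<Rightarrow> config) \<Rightarrow> ennreal" where
  "depletion_time n x = (INF t\<in>{t. 0 \<le> t \<and> (\<forall>i\<in>{1..n}. x t i \<noteq> St1)}. ennreal t)"

definition star_rates :: "nat \<Rightarrow> nat \<Rightarrow> nat \<Rightarrow> real" where
  "star_rates n i j =
     (if i = 1 \<and> j \<in> {2..n} \<or> j = 1 \<and> i \<in> {2..n} then 1 / (real n - 1) else 0)"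

end

theory Submission
  imports Defs
begin

text \<open>
For the depletion of state 1 the states \<open>e\<^sub>0\<close> and \<open>e\<^sub>1\<close> can be identified, and the difference
\<open>d = (2 \<alpha> - 1) n\<close> between the numbers of 0s and of 1s is conserved.  The star is thereby
described by the state of the hub and the number \<open>b\<close> of 1s.  Every annihilation of a 0 with a 1 leaves
the hub in an intermediate state, so the process regenerates at each decrease of \<open>b\<close>.
First-step analysis yields the mean time at level \<open>b\<close> in closed form,
\<open>\<tau>\<^sub>b = (n - 1) (n\<^sup>2 - a b) / (a b (2 n - a - b))\<close> with \<open>a = b + d\<close>.  For \<open>b\<close> small compared with
\<open>n\<close> this is close to \<open>c n / b\<close>, where \<open>c = 1 / ((2 \<alpha> - 1) (3 - 2 \<alpha>))\<close>, and it
differs from \<open>c (n - 1) / b\<close> by a bounded amount at all levels.  Summation over the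
\<open>(1 - \<alpha>) n\<close> levels gives \<open>c n\<close> times a harmonic number, up to \<open>O(n)\<close>
(\<open>levels_time_asymp\<close>).  The initial state of the hub matters only by a bounded amount
(\<open>mean_time_near_levels_time\<close>).

The probabilistic part justifies first-step analysis for a process that is given by its driving
Poisson processes only (\<open>expected_hitting_time\<close>, for arbitrary contact rates): a nonnegative function
\<open>f\<close> which vanishes on an absorbing set and which the generator maps to \<open>- 1\<close> outside of it is the
expected hitting time of the set.  Time is cut into periods of length \<open>h\<close>.  Two or more contacts
in one period have probability \<open>O(h\<^sup>2)\<close>, so the state is approximated by a chain that
applies at most one update per period.  Approximation on finer and finer grids shows that the state at
time \<open>s\<close> is independent of the contacts after \<open>s\<close> (\<open>prob_Z_incr\<close>), and that an absorbing set is
absorbing along almost every path (\<open>AE_stays\<close>).  Hence the mean of \<open>f\<close> decreases over a period by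
\<open>h + O(h\<^sup>2)\<close> times the probability of not having hit the set (\<open>one_step\<close>).  These
probabilities, summed over all periods and multiplied by \<open>h\<close>, approximate the expected hitting time;
as \<open>h\<close> tends to 0 it is seen to equal the initial value of \<open>f\<close>.
\<close>

section \<open>Independence of the contact counts\<close>

text \<open>Independence between the processes of different pairs and independence of the increments of each
process combine into joint independence of all increments: an event about the increments of one
process is an event about its path, so probabilities factor over the pairs, and then over the
increments.\<close>

lemma (in prob_space) indep_vars_blocks:
  fixes D :: "'i \<Rightarrow> 'j \<Rightarrow> 'a \<Rightarrow> 'c"
  assumes fin: "finite I" "finite J" and ne: "I \<noteq> {}" "J \<noteq> {}"
    and out: "indep_vars S Y I"
    and inn: "\<And>i. i \<in> I \<Longrightarrow> indep_vars (\<lambda>_. T) (D i) J"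
    and factor: "\<And>i j. i \<in> I \<Longrightarrow> j \<in> J \<Longrightarrow> \<exists>g\<in>measurable (S i) T. \<forall>\<omega>\<in>space M. D i j \<omega> = g (Y i \<omega>)"
  shows "indep_vars (\<lambda>_. T) (\<lambda>(i, j). D i j) (I \<times> J)"
proof -
  have rv: "random_variable T (D i j)" if "i \<in> I" "j \<in> J" for i j
    using inn[OF that(1)] that(2) by (auto simp: indep_vars_def)
  have Yrv: "random_variable (S i) (Y i)" if "i \<in> I" for i
    using out that by (auto simp: indep_vars_def)
  have "\<forall>A\<in>(\<Pi> p\<in>I \<times> J. sets T).
      prob (\<Inter>p\<in>I \<times> J. (case p of (i, j) \<Rightarrow> D i j) -` A p \<inter> space M) =
      (\<Prod>p\<in>I \<times> J. prob ((case p of (i, j) \<Rightarrow> D i j) -` A p \<inter> space M))"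
  proof
    fix A assume A: "A \<in> (\<Pi> p\<in>I \<times> J. sets T)"
    have As: "A (i, j) \<in> sets T" if "i \<in> I" "j \<in> J" for i j using A that by auto
    obtain g where g: "\<And>i j. i \<in> I \<Longrightarrow> j \<in> J \<Longrightarrow> g i j \<in> measurable (S i) T"
      and gD: "\<And>i j \<omega>. i \<in> I \<Longrightarrow> j \<in> J \<Longrightarrow> \<omega> \<in> space M \<Longrightarrow> D i j \<omega> = g i j (Y i \<omega>)"
      using factor by metis
    define B where "B i = (\<Inter>j\<in>J. g i j -` A (i, j) \<inter> space (S i))" for i
    have B: "B i \<in> sets (S i)" if "i \<in> I" for i
      unfolding B_def using fin ne that g As
      by (intro sets.finite_INT) (auto intro: measurable_sets)
    have YB: "Y i -` B i \<inter> space M = (\<Inter>j\<in>J. D i j -` A (i, j) \<inter> space M)" if "i \<in> I" for i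
      using gD[OF that] ne measurable_space[OF Yrv[OF that]]
      unfolding B_def by auto
    have "(\<Inter>p\<in>I \<times> J. (case p of (i, j) \<Rightarrow> D i j) -` A p \<inter> space M) = (\<Inter>i\<in>I. Y i -` B i \<inter> space M)"
      using YB ne by auto
    also have "prob \<dots> = (\<Prod>i\<in>I. prob (Y i -` B i \<inter> space M))"
      by (rule indep_varsD_finite[OF out]) (use fin ne B in auto)
    also have "\<dots> = (\<Prod>i\<in>I. \<Prod>j\<in>J. prob (D i j -` A (i, j) \<inter> space M))"
      by (intro prod.cong refl)
         (use YB indep_varsD_finite[OF inn] fin ne As in auto)
    also have "\<dots> = (\<Prod>p\<in>I \<times> J. prob ((case p of (i, j) \<Rightarrow> D i j) -` A p \<inter> space M))"
      by (simp add: prod.cartesian_product case_prod_unfold)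
    finally show "prob (\<Inter>p\<in>I \<times> J. (case p of (i, j) \<Rightarrow> D i j) -` A p \<inter> space M) =
      (\<Prod>p\<in>I \<times> J. prob ((case p of (i, j) \<Rightarrow> D i j) -` A p \<inter> space M))" .
  qed
  then show ?thesis
    by (subst indep_vars_finite[where E="\<lambda>_. sets T"])
       (use fin ne rv in \<open>auto simp: sets.sigma_sets_eq Int_stable_def sets.space_closed\<close>)
qed

lemma finite_node_pairs [simp]: "finite (node_pairs n)"
  by (rule finite_subset[of _ "{1..n} \<times> {1..n}"]) (auto simp: node_pairs_def)

lemma node_pairs_nonempty: "2 \<le> n \<Longrightarrow> node_pairs n \<noteq> {}"
proof -
  assume "2 \<le> n"
  then have "(1, 2) \<in> node_pairs n" by (simp add: node_pairs_def)
  then show ?thesis by blast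
qed

text \<open>A vector \<open>v\<close> holds the numbers of contacts of the pairs during some period.  The driving condition
on the path determines the update over the period unless it is crowded.\<close>

definition quiet :: "nat \<Rightarrow> (nat \<times> nat \<Rightarrow> nat) \<Rightarrow> bool" where
  "quiet n v \<longleftrightarrow> (\<forall>e\<in>node_pairs n. v e = 0)"

definition only_at :: "nat \<Rightarrow> nat \<times> nat \<Rightarrow> (nat \<times> nat \<Rightarrow> nat) \<Rightarrow> bool" where
  "only_at n e v \<longleftrightarrow> e \<in> node_pairs n \<and> v e = 1 \<and> (\<forall>e'\<in>node_pairs n - {e}. v e' = 0)"

definition crowded :: "nat \<Rightarrow> (nat \<times> nat \<Rightarrow> nat) \<Rightarrow> bool" where
  "crowded n v \<longleftrightarrow> 2 \<le> (\<Sum>e\<in>node_pairs n. v e)"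

lemma only_at_unique: "only_at n e v \<Longrightarrow> only_at n e' v \<Longrightarrow> e = e'"
  unfolding only_at_def by (metis DiffI singletonD zero_neq_one)

lemma not_quiet_only_at: "only_at n e v \<Longrightarrow> \<not> quiet n v"
  unfolding only_at_def quiet_def by force

lemma crowded_iff: "crowded n v \<longleftrightarrow> \<not> quiet n v \<and> (\<forall>e. \<not> only_at n e v)"
proof
  assume "crowded n v"
  moreover have "sum v (node_pairs n) = 1" if "only_at n e v" for e
    using that unfolding only_at_def by (subst sum.remove[of _ e]) auto
  ultimately show "\<not> quiet n v \<and> (\<forall>e. \<not> only_at n e v)"
    unfolding crowded_def quiet_def by (metis not_numeral_le_zero one_less_numeral_iff linorder_not_le semiring_norm(76) sum.neutral)
next
  assume *: "\<not> quiet n v \<and> (\<forall>e. \<not> only_at n e v)"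
  then obtain e where e: "e \<in> node_pairs n" "v e \<noteq> 0" by (auto simp: quiet_def)
  have sum: "sum v (node_pairs n) = v e + sum v (node_pairs n - {e})"
    using e by (subst sum.remove[of _ e]) auto
  have "v e \<noteq> 1 \<or> sum v (node_pairs n - {e}) \<noteq> 0"
    using * e unfolding only_at_def by (metis finite_Diff finite_node_pairs sum_eq_0_iff)
  with e show "crowded n v" unfolding crowded_def sum by linarith
qed

text \<open>For a crowded period the value is an arbitrary default; it is used only where crowded periods have
been excluded or have small probability.\<close>

definition jump :: "nat \<Rightarrow> (nat \<times> nat \<Rightarrow> nat) \<Rightarrow> config \<Rightarrow> config" where
  "jump n v x = (if \<exists>e. only_at n e v then case_prod contact (THE e. only_at n e v) x else x)"

lemma jump_only_at: "only_at n e v \<Longrightarrow> jump n v x = case_prod contact e x"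
  unfolding jump_def using only_at_unique by (metis the_equality)

lemma jump_quiet: "quiet n v \<Longrightarrow> jump n v x = x"
  unfolding jump_def using not_quiet_only_at by metis

lemma jump_cong:
  assumes "\<And>e. e \<in> node_pairs n \<Longrightarrow> v e = w e"
  shows "jump n v x = jump n w x"
proof -
  have "only_at n e v = only_at n e w" for e unfolding only_at_def using assms by (metis DiffD1)
  then show ?thesis unfolding jump_def by simp
qed

lemma crowded_mono: "(\<And>e. e \<in> node_pairs n \<Longrightarrow> v e \<le> w e) \<Longrightarrow> crowded n v \<Longrightarrow> crowded n w"
  unfolding crowded_def by (meson order.trans sum_mono)

fun chain :: "nat \<Rightarrow> (nat \<Rightarrow> nat \<times> nat \<Rightarrow> nat) \<Rightarrow> nat \<Rightarrow> config \<Rightarrow> config" where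
  "chain n v 0 x = x"
| "chain n v (Suc j) x = jump n (v j) (chain n v j x)"

lemma chain_cong:
  assumes "\<And>i e. i < j \<Longrightarrow> e \<in> node_pairs n \<Longrightarrow> v i e = w i e"
  shows "chain n v j x = chain n w j x"
  using assms
proof (induction j)
  case (Suc j)
  then show ?case using jump_cong[of n "v j" "w j"] by simp
qed simp

section \<open>Increments and single contacts\<close>

locale driven_consensus = prob_space M for M :: "'a measure" +
  fixes n :: nat and Q :: "nat \<Rightarrow> nat \<Rightarrow> real" and x0 :: config
    and N :: "nat \<times> nat \<Rightarrow> real \<Rightarrow> 'a \<Rightarrow> nat" and X :: "real \<Rightarrow> 'a \<Rightarrow> config"
  assumes consensus: "interval_consensus M n Q x0 N X" and two_nodes: "2 \<le> n"
begin

definition incr :: "real \<Rightarrow> real \<Rightarrow> 'a \<Rightarrow> nat \<times> nat \<Rightarrow> nat" where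
  "incr s t \<omega> e = N e t \<omega> - N e s \<omega>"

definition total_rate :: real where
  "total_rate = (\<Sum>e\<in>node_pairs n. case_prod Q e)"

lemma poisson: "e \<in> node_pairs n \<Longrightarrow> poisson_process M (case_prod Q e) (N e)"
  using consensus unfolding interval_consensus_def by (auto split: prod.splits)

lemma rate_nonneg: "e \<in> node_pairs n \<Longrightarrow> 0 \<le> case_prod Q e"
  using consensus unfolding interval_consensus_def contact_rates_def node_pairs_def by auto

lemma total_rate_nonneg: "0 \<le> total_rate"
  unfolding total_rate_def by (intro sum_nonneg rate_nonneg)

lemma N_measurable [measurable]:
  "e \<in> node_pairs n \<Longrightarrow> 0 \<le> t \<Longrightarrow> N e t \<in> measurable M (count_space UNIV)"
  using poisson[of e] unfolding poisson_process_def by auto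

lemma indep_increments:
  assumes "0 \<le> \<tau> 0" "incseq \<tau>" "e \<in> node_pairs n"
  shows "indep_vars (\<lambda>_. count_space UNIV) (\<lambda>k \<omega>. incr (\<tau> k) (\<tau> (Suc k)) \<omega> e) UNIV"
  using poisson[OF assms(3)] assms(1,2) unfolding poisson_process_def incr_def by auto

lemma indep_incr_grid:
  assumes \<tau>: "0 \<le> \<tau> 0" "incseq \<tau>"
  shows "indep_vars (\<lambda>_. count_space UNIV)
    (\<lambda>(e, j) \<omega>. incr (\<tau> j) (\<tau> (Suc j)) \<omega> e) (node_pairs n \<times> {..k})"
proof (rule indep_vars_blocks[where S="\<lambda>_. PiM {0..} (\<lambda>_. count_space UNIV)"
        and Y="\<lambda>e \<omega>. \<lambda>t\<in>{0..}. N e t \<omega>" and D="\<lambda>e j \<omega>. incr (\<tau> j) (\<tau> (Suc j)) \<omega> e"])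
  show "indep_vars (\<lambda>_. PiM {0..} (\<lambda>_. count_space UNIV)) (\<lambda>e \<omega>. \<lambda>t\<in>{0..}. N e t \<omega>) (node_pairs n)"
    using consensus unfolding interval_consensus_def by auto
  show "indep_vars (\<lambda>_. count_space UNIV) (\<lambda>j \<omega>. incr (\<tau> j) (\<tau> (Suc j)) \<omega> e) {..k}"
    if "e \<in> node_pairs n" for e
    using indep_increments[OF \<tau> that] by (rule indep_vars_subset) auto
  have nn: "0 \<le> \<tau> j" for j using \<tau> by (meson incseq_def le0 order.trans)
  show "\<exists>g\<in>measurable (PiM {0..} (\<lambda>_. count_space UNIV)) (count_space UNIV). \<forall>\<omega>\<in>space M.
      incr (\<tau> j) (\<tau> (Suc j)) \<omega> e = g (\<lambda>t\<in>{0..}. N e t \<omega>)" for e j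
  proof (intro bexI ballI)
    show "incr (\<tau> j) (\<tau> (Suc j)) \<omega> e = (\<lambda>y. y (\<tau> (Suc j)) - y (\<tau> j)) (\<lambda>t\<in>{0..}. N e t \<omega>)" for \<omega>
      using nn by (simp add: incr_def)
    have m: "(\<lambda>y. y (\<tau> i)) \<in> measurable (PiM {0..} (\<lambda>_. count_space UNIV)) (count_space (UNIV :: nat set))" for i
      using nn by (intro measurable_component_singleton) auto
    show "(\<lambda>y. y (\<tau> (Suc j)) - y (\<tau> j :: real)) \<in> measurable (PiM {0..} (\<lambda>_. count_space UNIV)) (count_space (UNIV :: nat set))"
      by (rule measurable_compose_countable[where f="\<lambda>i y. y (\<tau> (Suc j)) - i" and g="\<lambda>y. y (\<tau> j)"])
         (auto intro: m measurable_compose[OF m])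
  qed
qed (use node_pairs_nonempty[OF two_nodes] in auto)

lemma restrict_incr_measurable:
  assumes "0 \<le> s" "0 \<le> t"
  shows "(\<lambda>\<omega>. restrict (incr s t \<omega>) (node_pairs n)) \<in> measurable M (count_space UNIV)"
proof -
  have "(\<lambda>\<omega>. restrict (incr s t \<omega>) (node_pairs n)) \<in> measurable M (PiM (node_pairs n) (\<lambda>_. count_space UNIV))"
    unfolding incr_def by (rule measurable_restrict) (use assms in measurable)
  then show ?thesis
    using measurable_compose[of _ M "count_space (PiE (node_pairs n) (\<lambda>_. UNIV))" "\<lambda>v. v" "count_space UNIV"]
    by (subst (asm) count_space_PiM_finite) auto
qed

text \<open>The state of the discretised process after \<open>k\<close> periods is a function of the contact counts of these
periods, hence independent of what happens in the next one.\<close>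

lemma prob_chain_incr:
  assumes \<tau>: "0 \<le> \<tau> 0" "incseq \<tau>"
    and B: "\<And>v w. (\<And>e. e \<in> node_pairs n \<Longrightarrow> v e = w e) \<Longrightarrow> B v = B w"
  shows "prob {\<omega>\<in>space M. chain n (\<lambda>j. incr (\<tau> j) (\<tau> (Suc j)) \<omega>) k x \<in> A \<and> B (incr (\<tau> k) (\<tau> (Suc k)) \<omega>)} =
    prob {\<omega>\<in>space M. chain n (\<lambda>j. incr (\<tau> j) (\<tau> (Suc j)) \<omega>) k x \<in> A} *
    prob {\<omega>\<in>space M. B (incr (\<tau> k) (\<tau> (Suc k)) \<omega>)}"
proof -
  let ?P = "node_pairs n" and ?D = "\<lambda>(e, j) \<omega>. incr (\<tau> j) (\<tau> (Suc j)) \<omega> e"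
  let ?I = "?P \<times> {..<k}" and ?J = "?P \<times> {k}" and ?C = "\<lambda>_. count_space (UNIV :: nat set)"
  let ?R = "\<lambda>K \<omega>. restrict (\<lambda>i. ?D i \<omega>) K"
  define SA where "SA = {d \<in> PiE ?I (\<lambda>_. UNIV). chain n (\<lambda>j e. d (e, j)) k x \<in> A}"
  define SB where "SB = {d \<in> PiE ?J (\<lambda>_. UNIV). B (\<lambda>e. d (e, k))}"
  have "indep_var (PiM ?I ?C) (?R ?I) (PiM ?J ?C) (?R ?J)"
    by (rule indep_var_restrict[OF indep_incr_grid[OF \<tau>, of k]]) auto
  then have "prob ((\<lambda>\<omega>. (?R ?I \<omega>, ?R ?J \<omega>)) -` (SA \<times> SB) \<inter> space M) =
      prob (?R ?I -` SA \<inter> space M) * prob (?R ?J -` SB \<inter> space M)"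
    by (rule indep_varD) (subst count_space_PiM_finite; auto simp: SA_def SB_def)+
  moreover have chain_eq: "chain n (\<lambda>j e. ?R ?I \<omega> (e, j)) k x = chain n (\<lambda>j. incr (\<tau> j) (\<tau> (Suc j)) \<omega>) k x" for \<omega>
    by (rule chain_cong) auto
  moreover have B_eq: "B (\<lambda>e. ?R ?J \<omega> (e, k)) = B (incr (\<tau> k) (\<tau> (Suc k)) \<omega>)" for \<omega>
    by (rule B) auto
  have "?R ?I \<omega> \<in> SA \<longleftrightarrow> chain n (\<lambda>j. incr (\<tau> j) (\<tau> (Suc j)) \<omega>) k x \<in> A" for \<omega>
    unfolding SA_def mem_Collect_eq chain_eq by auto
  moreover have "?R ?J \<omega> \<in> SB \<longleftrightarrow> B (incr (\<tau> k) (\<tau> (Suc k)) \<omega>)" for \<omega>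
    unfolding SB_def mem_Collect_eq B_eq by auto
  ultimately show ?thesis
    by (simp add: vimage_def Int_def conj_commute cong: conj_cong)
qed

lemma prob_incr:
  assumes "0 \<le> s" "s < t"
  shows "prob {\<omega>\<in>space M. \<forall>e\<in>node_pairs n. incr s t \<omega> e = v e} =
    (\<Prod>e\<in>node_pairs n. exp (- (case_prod Q e * (t - s))) * (case_prod Q e * (t - s)) ^ v e / fact (v e))"
proof -
  let ?P = "node_pairs n"
  let ?\<tau> = "\<lambda>j::nat. if j = 0 then s else t"
  have inc: "incseq ?\<tau>" using assms by (auto simp: incseq_def)
  let ?D = "\<lambda>(e, j) \<omega>. incr (?\<tau> j) (?\<tau> (Suc j)) \<omega> e"
  have "{\<omega>\<in>space M. \<forall>e\<in>?P. incr s t \<omega> e = v e} = (\<Inter>p\<in>?P \<times> {..0}. ?D p -` {v (fst p)} \<inter> space M)"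
    using node_pairs_nonempty[OF two_nodes] by auto
  also have "prob \<dots> = (\<Prod>p\<in>?P \<times> {..0}. prob (?D p -` {v (fst p)} \<inter> space M))"
    by (rule indep_varsD_finite[OF indep_incr_grid]) (use inc assms node_pairs_nonempty[OF two_nodes] in auto)
  also have "\<dots> = (\<Prod>e\<in>?P. prob {\<omega>\<in>space M. N e t \<omega> - N e s \<omega> = v e})"
  proof (rule prod.reindex_bij_witness[where j=fst and i="\<lambda>e. (e, 0)"])
  qed (auto simp: incr_def intro!: arg_cong[where f=prob])
  also have "\<dots> = (\<Prod>e\<in>?P. exp (- (case_prod Q e * (t - s))) * (case_prod Q e * (t - s)) ^ v e / fact (v e))"
  proof (rule prod.cong)
    fix e assume "e \<in> ?P"
    from poisson[OF this] assms show "prob {\<omega>\<in>space M. N e t \<omega> - N e s \<omega> = v e} =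
      exp (- (case_prod Q e * (t - s))) * (case_prod Q e * (t - s)) ^ v e / fact (v e)"
      unfolding poisson_process_def by auto
  qed simp
  finally show ?thesis .
qed

lemma prob_quiet:
  assumes "0 \<le> s" "s < t"
  shows "prob {\<omega>\<in>space M. quiet n (incr s t \<omega>)} = exp (- (total_rate * (t - s)))"
  using prob_incr[OF assms, of "\<lambda>_. 0"] unfolding quiet_def total_rate_def
  by (simp add: exp_sum[symmetric] sum_negf sum_distrib_right)

lemma prob_only_at:
  assumes "0 \<le> s" "s < t" "e \<in> node_pairs n"
  shows "prob {\<omega>\<in>space M. only_at n e (incr s t \<omega>)} =
    case_prod Q e * (t - s) * exp (- (total_rate * (t - s)))"
proof -
  let ?P = "node_pairs n" and ?v = "\<lambda>e'. if e' = e then 1 else 0 :: nat"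
  have "{\<omega>\<in>space M. only_at n e (incr s t \<omega>)} = {\<omega>\<in>space M. \<forall>e'\<in>?P. incr s t \<omega> e' = ?v e'}"
    using assms unfolding only_at_def by (auto split: if_splits)
  also have "prob \<dots> = (\<Prod>e'\<in>?P. exp (- (case_prod Q e' * (t - s))) * (case_prod Q e' * (t - s)) ^ ?v e' / fact (?v e'))"
    by (rule prob_incr) fact+
  also have "\<dots> = (\<Prod>e'\<in>?P. exp (- (case_prod Q e' * (t - s))) * (if e' = e then case_prod Q e * (t - s) else 1))"
    by (intro prod.cong) auto
  also have "\<dots> = exp (- (total_rate * (t - s))) * (case_prod Q e * (t - s))"
    unfolding prod.distrib total_rate_def
    using assms by (simp add: exp_sum[symmetric] sum_negf sum_distrib_right prod.delta)
  finally show ?thesis by (simp add: mult_ac)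
qed

end

section \<open>Deterministic paths between crowded periods\<close>

definition contact_closed :: "nat \<Rightarrow> config set \<Rightarrow> bool" where
  "contact_closed n C \<longleftrightarrow> (\<forall>x\<in>C. \<forall>(i, j)\<in>node_pairs n. contact i j x \<in> C)"

lemma jump_closed: "contact_closed n C \<Longrightarrow> x \<in> C \<Longrightarrow> jump n v x \<in> C"
proof (cases "\<exists>e. only_at n e v")
  case True
  assume C: "contact_closed n C" "x \<in> C"
  from True obtain i j where e: "only_at n (i, j) v" by auto
  then have "(i, j) \<in> node_pairs n" by (simp add: only_at_def)
  with C show ?thesis by (auto simp: jump_only_at[OF e] contact_closed_def)
next
  case False
  assume C: "contact_closed n C" "x \<in> C"
  with False show ?thesis by (simp add: jump_def)
qed

locale contact_path =
  fixes n :: nat and x0 :: config and N :: "nat \<times> nat \<Rightarrow> real \<Rightarrow> nat" and x :: "real \<Rightarrow> config"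
  assumes path: "consensus_path n x0 N x"
    and mono: "\<And>e. e \<in> node_pairs n \<Longrightarrow> mono_on {0..} (N e)"
begin

lemma start: "x 0 = x0"
  using path by (simp add: consensus_path_def)

lemma step:
  assumes st: "0 \<le> s" "s \<le> t" and nc: "\<not> crowded n (\<lambda>e. N e t - N e s)"
  shows "x t = jump n (\<lambda>e. N e t - N e s) (x s)"
proof (cases "s = t")
  case True
  then show ?thesis by (simp add: jump_quiet quiet_def)
next
  case False
  with st have st': "0 \<le> s" "s < t" by auto
  have le: "N e s \<le> N e t" if "e \<in> node_pairs n" for e
    using mono[OF that] st by (auto simp: mono_on_def)
  consider (q) "quiet n (\<lambda>e. N e t - N e s)" | (s) e where "only_at n e (\<lambda>e. N e t - N e s)"
    using nc crowded_iff by blast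
  then show ?thesis
  proof cases
    case q
    then have "\<forall>e\<in>node_pairs n. N e t = N e s"
      using le unfolding quiet_def by (metis diff_is_0_eq order_antisym)
    with path st' have "x t = x s" unfolding consensus_path_def by blast
    with q show ?thesis by (simp add: jump_quiet)
  next
    case (s e)
    obtain i j where e: "e = (i, j)" by (cases e)
    have ij: "(i, j) \<in> node_pairs n" and "N (i, j) t - N (i, j) s = 1"
      and rest: "\<forall>e\<in>node_pairs n - {(i, j)}. N e t - N e s = 0"
      using s unfolding only_at_def e by auto
    then have "N (i, j) t = N (i, j) s + 1" by linarith
    moreover have "N e t = N e s" if "e \<in> node_pairs n - {(i, j)}" for e
    proof -
      have "N e t - N e s = 0" "N e s \<le> N e t" using rest le[of e] that by blast+
      then show ?thesis by linarith
    qed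
    ultimately have "x t = contact i j (x s)"
      using path st' ij unfolding consensus_path_def by blast
    with s show ?thesis by (simp add: jump_only_at e)
  qed
qed

lemma at_grid:
  assumes \<tau>: "\<tau> 0 = 0" "incseq \<tau>"
    and nc: "\<And>j. j < k \<Longrightarrow> \<not> crowded n (\<lambda>e. N e (\<tau> (Suc j)) - N e (\<tau> j))"
  shows "x (\<tau> k) = chain n (\<lambda>j e. N e (\<tau> (Suc j)) - N e (\<tau> j)) k x0"
  using nc
proof (induction k)
  case 0
  then show ?case by (simp add: \<tau> start)
next
  case (Suc k)
  have "0 \<le> \<tau> k" "\<tau> k \<le> \<tau> (Suc k)" using incseqD[OF \<tau>(2), of 0 k] \<tau> incseq_SucD by auto
  from step[OF this] Suc show ?case by simp
qed

text \<open>If a grid has no crowded cell then between any two times below its end the path makes finitely many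
single updates, since a part of a cell that is not crowded is not crowded either.  A set that is
closed under contacts can therefore not be left, at any real time and not just at the grid points.\<close>

lemma stays:
  assumes \<tau>: "\<tau> 0 = 0" "incseq \<tau>"
    and nc: "\<And>j. j < k \<Longrightarrow> \<not> crowded n (\<lambda>e. N e (\<tau> (Suc j)) - N e (\<tau> j))"
    and C: "contact_closed n C" "x s \<in> C" and st: "0 \<le> s" "s \<le> t" "t \<le> \<tau> k"
  shows "x t \<in> C"
  using nc C(2) st
proof (induction k arbitrary: s t)
  case 0
  with \<tau> have "t = s" by simp
  with 0 show ?case by simp
next
  case (Suc k)
  have one: "x v \<in> C" if "x u \<in> C" "0 \<le> u" "\<tau> k \<le> u" "u \<le> v" "v \<le> \<tau> (Suc k)" for u v
  proof -
    have \<tau>0: "0 \<le> \<tau> k" using \<tau> by (metis incseqD le0)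
    have le: "N e v - N e u \<le> N e (\<tau> (Suc k)) - N e (\<tau> k)" if "e \<in> node_pairs n" for e
    proof -
      have "N e v \<le> N e (\<tau> (Suc k))" "N e (\<tau> k) \<le> N e u"
        using mono[OF that] \<open>0 \<le> u\<close> \<tau>0 \<open>\<tau> k \<le> u\<close> \<open>u \<le> v\<close> \<open>v \<le> \<tau> (Suc k)\<close> by (auto simp: mono_on_def)
      then show ?thesis by simp
    qed
    have "\<not> crowded n (\<lambda>e. N e v - N e u)"
    proof
      assume "crowded n (\<lambda>e. N e v - N e u)"
      then have "crowded n (\<lambda>e. N e (\<tau> (Suc k)) - N e (\<tau> k))"
        by (rule crowded_mono[rotated]) (rule le)
      with Suc.prems(1)[of k] show False by simp
    qed
    from step[OF _ _ this] that jump_closed[OF C(1)] show ?thesis by auto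
  qed
  consider "t \<le> \<tau> k" | "\<tau> k \<le> s" | "s \<le> \<tau> k" "\<tau> k \<le> t" by linarith
  then show ?case
  proof cases
    case 1
    then show ?thesis using Suc by auto
  next
    case 2
    then show ?thesis using one Suc.prems by auto
  next
    case 3
    then have "x (\<tau> k) \<in> C" using Suc by auto
    then show ?thesis using one[of "\<tau> k" t] 3 Suc.prems by auto
  qed
qed

end

section \<open>Approximation by the discretised process\<close>

lemma finite_UNIV_opinion: "finite (UNIV :: opinion set)"
proof -
  have "UNIV = {St0, Ste0, Ste1, St1}" by (auto intro: opinion.exhaust)
  then show ?thesis by (metis finite.emptyI finite_insert)
qed

context driven_consensus begin

abbreviation nodes :: "nat set" where "nodes \<equiv> {1..n}"

text \<open>Only the states of the nodes \<open>1, \<dots>, n\<close> are assumed to be measurable.  Resetting the other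
coordinates to their initial values yields a random configuration with finitely many values, which
almost surely agrees with \<open>X\<close> at all times.\<close>

definition Z :: "real \<Rightarrow> 'a \<Rightarrow> config" where
  "Z t \<omega> = override_on x0 (X t \<omega>) nodes"

definition configs :: "config set" where
  "configs = {x. \<forall>i. i \<notin> nodes \<longrightarrow> x i = x0 i}"

lemma Z_configs: "Z t \<omega> \<in> configs"
  by (simp add: Z_def configs_def)

lemma finite_configs: "finite configs"
proof -
  have "configs \<subseteq> (\<lambda>y. override_on x0 y nodes) ` (PiE nodes (\<lambda>_. UNIV))"
  proof
    fix x assume x: "x \<in> configs"
    have "x = override_on x0 (restrict x nodes) nodes"
      using x by (auto simp: configs_def override_on_def fun_eq_iff)
    then show "x \<in> (\<lambda>y. override_on x0 y nodes) ` (PiE nodes (\<lambda>_. UNIV))"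
      by (intro image_eqI[where x="restrict x nodes"]) auto
  qed
  moreover have "finite (PiE nodes (\<lambda>_. UNIV :: opinion set))"
    by (intro finite_PiE finite_UNIV_opinion) auto
  ultimately show ?thesis by (metis finite_imageI finite_subset)
qed

lemma configs_closed: "contact_closed n configs"
  by (auto simp: contact_closed_def configs_def contact_def node_pairs_def)

lemma Z_measurable [measurable]:
  assumes "0 \<le> t"
  shows "Z t \<in> measurable M (count_space UNIV)"
proof -
  have "(\<lambda>\<omega>. restrict (X t \<omega>) nodes) \<in> measurable M (PiM nodes (\<lambda>_. count_space UNIV))"
    by (rule measurable_restrict) (use consensus assms in \<open>auto simp: interval_consensus_def\<close>)
  then have "(\<lambda>\<omega>. restrict (X t \<omega>) nodes) \<in> measurable M (count_space (PiE nodes (\<lambda>_. UNIV)))"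
    by (subst (asm) count_space_PiM_finite) (auto intro: countable_finite finite_UNIV_opinion)
  from measurable_compose[OF this, of "\<lambda>y. override_on x0 y nodes" "count_space UNIV"]
  have "(\<lambda>\<omega>. override_on x0 (restrict (X t \<omega>) nodes) nodes) \<in> measurable M (count_space UNIV)"
    by simp
  moreover have "override_on x0 (restrict (X t \<omega>) nodes) nodes = Z t \<omega>" for \<omega>
    by (auto simp: Z_def override_on_def)
  ultimately show ?thesis by (simp cong: measurable_cong)
qed

lemma incr_measurable:
  assumes "e \<in> node_pairs n" "0 \<le> s" "0 \<le> t"
  shows "(\<lambda>\<omega>. incr s t \<omega> e) \<in> measurable M (count_space UNIV)"
  unfolding incr_def using assms by measurable

lemma Z_event:
  assumes "0 \<le> t"
  shows "{\<omega>\<in>space M. Z t \<omega> \<in> A} \<in> events"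
  using measurable_sets[OF Z_measurable[OF assms], of A] by (simp add: vimage_def Int_def conj_commute)

lemma incr_event:
  assumes "0 \<le> s" "0 \<le> t" and B: "\<And>v w. (\<And>e. e \<in> node_pairs n \<Longrightarrow> v e = w e) \<Longrightarrow> B v = B w"
  shows "{\<omega>\<in>space M. B (incr s t \<omega>)} \<in> events"
proof -
  have "{\<omega>\<in>space M. B (restrict (incr s t \<omega>) (node_pairs n))} \<in> events"
    using measurable_sets[OF restrict_incr_measurable[OF assms(1,2)], of "Collect B"]
    by (simp add: vimage_def Int_def conj_commute)
  moreover have "B (restrict (incr s t \<omega>) (node_pairs n)) = B (incr s t \<omega>)" for \<omega>
    by (rule B) simp
  ultimately show ?thesis by simp
qed

lemma quiet_cong: "(\<And>e. e \<in> node_pairs n \<Longrightarrow> v e = w e) \<Longrightarrow> quiet n v = quiet n w"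
  by (simp add: quiet_def)

lemma only_at_cong: "(\<And>e. e \<in> node_pairs n \<Longrightarrow> v e = w e) \<Longrightarrow> only_at n e v = only_at n e w"
  unfolding only_at_def by (metis DiffD1)

lemma crowded_cong: "(\<And>e. e \<in> node_pairs n \<Longrightarrow> v e = w e) \<Longrightarrow> crowded n v = crowded n w"
  by (simp add: crowded_def)

lemmas quiet_event = incr_event[where B="quiet n", OF _ _ quiet_cong]
lemmas only_at_event = incr_event[where B="only_at n e" for e, OF _ _ only_at_cong]
lemmas crowded_event = incr_event[where B="crowded n", OF _ _ crowded_cong]

text \<open>With \<open>r\<close> the total rate times the length of the period, the probability of no contact is
\<open>exp (- r)\<close> and that of a single contact is \<open>r exp (- r)\<close>.  What remains is of second order, so
that refining a grid makes the crowded cells disappear.\<close>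

lemma prob_crowded:
  assumes st: "0 \<le> s" "s \<le> t"
  shows "prob {\<omega>\<in>space M. crowded n (incr s t \<omega>)} \<le> (total_rate * (t - s))\<^sup>2"
proof (cases "s = t")
  case True
  then have "\<not> crowded n (incr s t \<omega>)" for \<omega> by (simp add: crowded_def incr_def)
  then show ?thesis by simp
next
  case False
  with st have st': "0 \<le> s" "s < t" "0 \<le> t" by auto
  define r where "r = total_rate * (t - s)"
  let ?q = "{\<omega>\<in>space M. quiet n (incr s t \<omega>)}" and ?s = "\<lambda>e. {\<omega>\<in>space M. only_at n e (incr s t \<omega>)}"
  have "prob (\<Union>e\<in>node_pairs n. ?s e) = (\<Sum>e\<in>node_pairs n. prob (?s e))"
    by (rule finite_measure_finite_Union)
       (auto simp: disjoint_family_on_def only_at_event st' dest: only_at_unique)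
  also have "\<dots> = (\<Sum>e\<in>node_pairs n. case_prod Q e * (t - s) * exp (- r))"
    using prob_only_at st' by (auto simp: r_def)
  also have "\<dots> = r * exp (- r)"
    by (simp add: r_def total_rate_def sum_distrib_right)
  finally have union: "prob (\<Union>e\<in>node_pairs n. ?s e) = r * exp (- r)" .
  have "{\<omega>\<in>space M. crowded n (incr s t \<omega>)} = space M - (?q \<union> (\<Union>e\<in>node_pairs n. ?s e))"
    unfolding crowded_iff by (auto; use only_at_def in blast)
  also have "prob \<dots> = 1 - prob (?q \<union> (\<Union>e\<in>node_pairs n. ?s e))"
    by (rule prob_compl) (auto intro!: quiet_event only_at_event sets.Un sets.finite_UN st')
  also have "prob (?q \<union> (\<Union>e\<in>node_pairs n. ?s e)) = exp (- r) + r * exp (- r)"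
  proof (subst finite_measure_Union)
    show "?q \<inter> (\<Union>e\<in>node_pairs n. ?s e) = {}" using not_quiet_only_at by blast
  qed (auto simp: union prob_quiet st' r_def intro!: quiet_event only_at_event sets.finite_UN)
  also have "1 - (exp (- r) + r * exp (- r)) \<le> r\<^sup>2"
  proof -
    have "0 \<le> r" using total_rate_nonneg st by (simp add: r_def)
    moreover have "1 - r \<le> exp (- r)" using exp_ge_add_one_self[of "- r"] by simp
    ultimately have "(1 - r) * (1 + r) \<le> exp (- r) * (1 + r)" by (intro mult_right_mono) auto
    then show ?thesis by (simp add: algebra_simps power2_eq_square)
  qed
  finally show ?thesis by (simp add: r_def)
qed

lemma AE_path: "AE \<omega> in M. contact_path n x0 (\<lambda>e t. N e t \<omega>) (\<lambda>t. X t \<omega>)"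
proof -
  have "AE \<omega> in M. \<forall>e\<in>node_pairs n. mono_on {0..} (\<lambda>t. N e t \<omega>)"
    by (subst AE_ball_countable) (use poisson in \<open>auto simp: poisson_process_def countable_finite\<close>)
  moreover have "AE \<omega> in M. consensus_path n x0 (\<lambda>e t. N e t \<omega>) (\<lambda>t. X t \<omega>)"
    using consensus unfolding interval_consensus_def by auto
  ultimately show ?thesis
    by eventually_elim (simp add: contact_path_def)
qed

definition grid :: "real \<Rightarrow> nat \<Rightarrow> nat \<Rightarrow> real" where
  "grid s k j = s * real j / real k"

definition grid_crowded :: "real \<Rightarrow> nat \<Rightarrow> 'a set" where
  "grid_crowded s k = {\<omega>\<in>space M. \<exists>j<k. crowded n (incr (grid s k j) (grid s k (Suc j)) \<omega>)}"

lemma grid_0 [simp]: "grid s k 0 = 0" by (simp add: grid_def)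

lemma grid_nonneg: "0 \<le> s \<Longrightarrow> 0 \<le> grid s k j" by (simp add: grid_def)

lemma grid_mono: "0 \<le> s \<Longrightarrow> i \<le> j \<Longrightarrow> grid s k i \<le> grid s k j"
  by (simp add: grid_def divide_right_mono mult_left_mono)

lemma grid_end: "0 < k \<Longrightarrow> grid s k k = s" by (simp add: grid_def)

lemma grid_crowded_UN:
  "grid_crowded s k = (\<Union>j<k. {\<omega>\<in>space M. crowded n (incr (grid s k j) (grid s k (Suc j)) \<omega>)})"
  by (auto simp: grid_crowded_def)

lemma grid_crowded_event [measurable]: "0 \<le> s \<Longrightarrow> grid_crowded s k \<in> events"
  unfolding grid_crowded_UN by (auto intro!: sets.finite_UN crowded_event grid_nonneg)

lemma prob_grid_crowded:
  assumes s: "0 \<le> s" and k: "0 < k"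
  shows "prob (grid_crowded s k) \<le> (total_rate * s)\<^sup>2 / k"
proof -
  have "prob (grid_crowded s k) \<le> (\<Sum>j<k. prob {\<omega>\<in>space M. crowded n (incr (grid s k j) (grid s k (Suc j)) \<omega>)})"
    unfolding grid_crowded_UN
    by (rule finite_measure_subadditive_finite) (auto intro!: crowded_event grid_nonneg s)
  also have "\<dots> \<le> (\<Sum>j<k. (total_rate * (s / k))\<^sup>2)"
  proof (rule sum_mono)
    fix j
    have "grid s k (Suc j) - grid s k j = s / k" by (simp add: grid_def add_divide_distrib distrib_left)
    with prob_crowded[OF grid_nonneg[OF s] grid_mono[OF s, of j "Suc j" k]]
    show "prob {\<omega>\<in>space M. crowded n (incr (grid s k j) (grid s k (Suc j)) \<omega>)} \<le> (total_rate * (s / k))\<^sup>2"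
      by simp
  qed
  also have "\<dots> = (total_rate * s)\<^sup>2 / k"
    using k by (simp add: power2_eq_square)
  finally show ?thesis .
qed

text \<open>The probability that a grid of \<open>k\<close> cells has a crowded cell is at most of order \<open>1 / k\<close>, so almost
surely some grid has none.\<close>

lemma AE_grid: "AE \<omega> in M. \<forall>m::nat. \<exists>k>0. \<omega> \<notin> grid_crowded (real m) k"
proof (subst AE_all_countable, rule allI)
  fix m :: nat
  let ?B = "\<Inter>k. grid_crowded (real m) (Suc k)"
  have B: "?B \<in> events" by (intro sets.countable_INT) (auto simp: grid_crowded_event)
  have "prob ?B \<le> (total_rate * real m)\<^sup>2 / real (Suc k)" for k
  proof -
    have "prob ?B \<le> prob (grid_crowded (real m) (Suc k))"
      by (rule finite_measure_mono) (auto simp: grid_crowded_event)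
    also have "\<dots> \<le> (total_rate * real m)\<^sup>2 / real (Suc k)" by (rule prob_grid_crowded) auto
    finally show ?thesis .
  qed
  moreover have "(\<lambda>k. (total_rate * real m)\<^sup>2 / real (Suc k)) \<longlonglongrightarrow> 0"
    by (intro LIMSEQ_Suc lim_const_over_n)
  ultimately have "prob ?B \<le> 0" by (intro LIMSEQ_le_const) auto
  then have "prob ?B = 0" using measure_nonneg[of M ?B] by linarith
  with B have "AE \<omega> in M. \<omega> \<notin> ?B" by (simp add: prob_eq_0)
  then show "AE \<omega> in M. \<exists>k>0. \<omega> \<notin> grid_crowded (real m) k"
    by eventually_elim auto
qed

lemma AE_stays:
  "AE \<omega> in M. \<forall>C s t. contact_closed n C \<longrightarrow> 0 \<le> s \<longrightarrow> s \<le> t \<longrightarrow> X s \<omega> \<in> C \<longrightarrow> X t \<omega> \<in> C"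
  using AE_path AE_grid AE_space
proof eventually_elim
  case (elim \<omega>)
  interpret contact_path n x0 "\<lambda>e t. N e t \<omega>" "\<lambda>t. X t \<omega>" by fact
  show ?case
  proof (intro allI impI)
    fix C and s t :: real
    assume *: "contact_closed n C" "0 \<le> s" "s \<le> t" "X s \<omega> \<in> C"
    define m where "m = nat \<lceil>t\<rceil>"
    from elim obtain k where k: "0 < k" "\<omega> \<notin> grid_crowded (real m) k" by blast
    show "X t \<omega> \<in> C"
    proof (rule stays[where \<tau>="grid (real m) k" and k=k])
      show "incseq (grid (real m) k)" by (auto simp: incseq_def intro: grid_mono)
      show "\<not> crowded n (\<lambda>e. N e (grid (real m) k (Suc j)) \<omega> - N e (grid (real m) k j) \<omega>)" if "j < k" for j
        using k that elim by (auto simp: grid_crowded_def incr_def[abs_def])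
      show "t \<le> grid (real m) k k" using k * by (simp add: grid_end m_def)
    qed (use * in auto)
  qed
qed

lemma AE_Z: "AE \<omega> in M. \<forall>t\<ge>0. Z t \<omega> = X t \<omega>"
  using AE_stays AE_path
proof eventually_elim
  case (elim \<omega>)
  have "X 0 \<omega> = x0" using contact_path.start[OF elim(2)] .
  then have "X 0 \<omega> \<in> configs" by (simp add: configs_def)
  then have "X t \<omega> \<in> configs" if "0 \<le> t" for t
    using elim(1) configs_closed that by blast
  then show ?case
    by (auto simp: Z_def configs_def override_on_def fun_eq_iff)
qed

lemma chain_measurable:
  assumes "\<And>j. 0 \<le> \<tau> j"
  shows "(\<lambda>\<omega>. chain n (\<lambda>j. incr (\<tau> j) (\<tau> (Suc j)) \<omega>) k x) \<in> measurable M (count_space UNIV)"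
proof -
  let ?I = "node_pairs n \<times> {..<k}"
  let ?R = "\<lambda>\<omega>. \<lambda>p\<in>?I. incr (\<tau> (snd p)) (\<tau> (Suc (snd p))) \<omega> (fst p)"
  have "?R \<in> measurable M (PiM ?I (\<lambda>_. count_space UNIV))"
    by (rule measurable_restrict) (auto intro!: incr_measurable assms)
  then have R: "?R \<in> measurable M (count_space (PiE ?I (\<lambda>_. UNIV)))"
    by (subst (asm) count_space_PiM_finite) auto
  have "(\<lambda>\<omega>. chain n (\<lambda>j e. ?R \<omega> (e, j)) k x) \<in> measurable M (count_space UNIV)"
    using measurable_compose[OF R, of "\<lambda>d. chain n (\<lambda>j e. d (e, j)) k x" "count_space UNIV"] by simp
  moreover have "chain n (\<lambda>j e. ?R \<omega> (e, j)) k x = chain n (\<lambda>j. incr (\<tau> j) (\<tau> (Suc j)) \<omega>) k x" for \<omega>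
    by (rule chain_cong) auto
  ultimately show ?thesis by simp
qed

text \<open>The Markov property: the state at time \<open>s\<close> is independent of the contacts during \<open>(s, t]\<close>.  On a
grid of \<open>[0, s]\<close> without crowded cells the state is that of the discretised process, which is
independent of later contacts; the error vanishes as the grid is refined.\<close>

lemma prob_Z_incr:
  assumes st: "0 \<le> s" "s \<le> t"
    and B: "\<And>v w. (\<And>e. e \<in> node_pairs n \<Longrightarrow> v e = w e) \<Longrightarrow> B v = B w"
  shows "prob {\<omega>\<in>space M. Z s \<omega> \<in> A \<and> B (incr s t \<omega>)} =
    prob {\<omega>\<in>space M. Z s \<omega> \<in> A} * prob {\<omega>\<in>space M. B (incr s t \<omega>)}"
proof -
  let ?ZB = "prob {\<omega>\<in>space M. Z s \<omega> \<in> A \<and> B (incr s t \<omega>)}"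
  let ?Z = "prob {\<omega>\<in>space M. Z s \<omega> \<in> A}" and ?B = "prob {\<omega>\<in>space M. B (incr s t \<omega>)}"
  have Be: "{\<omega>\<in>space M. B (incr s t \<omega>)} \<in> events" using st by (intro incr_event B) auto
  have Ze: "{\<omega>\<in>space M. Z s \<omega> \<in> A} \<in> events" using st by (intro Z_event)
  have ZBe: "{\<omega>\<in>space M. Z s \<omega> \<in> A \<and> B (incr s t \<omega>)} \<in> events"
    by (rule back_subst[where P="\<lambda>S. S \<in> events", OF sets.Int[OF Ze Be]]) auto
  have close: "\<bar>prob U - prob V\<bar> \<le> prob W"
    if "U \<in> events" "V \<in> events" "W \<in> events" "AE \<omega> in M. \<omega> \<notin> W \<longrightarrow> (\<omega> \<in> U \<longleftrightarrow> \<omega> \<in> V)" for U V W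
  proof -
    have "prob U \<le> prob (V \<union> W)" "prob V \<le> prob (U \<union> W)"
      using that by (auto intro!: finite_measure_mono_AE)
    moreover have "prob (V \<union> W) \<le> prob V + prob W" "prob (U \<union> W) \<le> prob U + prob W"
      using that by (auto intro!: measure_Un_le)
    ultimately show ?thesis by linarith
  qed
  have "\<bar>?ZB - ?Z * ?B\<bar> \<le> 2 * ((total_rate * s)\<^sup>2 / real (Suc k))" for k
  proof -
    let ?k = "Suc k"
    \<comment> \<open>the grid of the first \<open>k + 1\<close> periods covers \<open>[0, s]\<close>, and period \<open>k + 1\<close> is \<open>(s, t]\<close>\<close>
    define \<tau> where "\<tau> j = (if j \<le> ?k then grid s ?k j else t)" for j
    have \<tau>0: "\<tau> 0 = 0" and \<tau>k: "\<tau> ?k = s" "\<tau> (Suc ?k) = t" by (auto simp: \<tau>_def grid_end)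
    have inc: "incseq \<tau>"
    proof -
      have "grid s ?k i \<le> t" if "i \<le> ?k" for i
        using grid_mono[OF st(1) that, of ?k] st by (simp add: grid_end)
      then show ?thesis using st by (auto simp: incseq_def \<tau>_def grid_mono)
    qed
    have nn: "0 \<le> \<tau> j" for j using inc \<tau>0 by (metis incseqD le0)
    let ?Y = "\<lambda>\<omega>. chain n (\<lambda>j. incr (\<tau> j) (\<tau> (Suc j)) \<omega>) ?k x0"
    let ?W = "grid_crowded s ?k"
    have Ye: "{\<omega>\<in>space M. ?Y \<omega> \<in> A} \<in> events"
      using measurable_sets[OF chain_measurable[OF nn, where x=x0 and k="?k"], of A]
      by (simp add: vimage_def Int_def conj_commute)
    have YBe: "{\<omega>\<in>space M. ?Y \<omega> \<in> A \<and> B (incr s t \<omega>)} \<in> events"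
      by (rule back_subst[where P="\<lambda>S. S \<in> events", OF sets.Int[OF Ye Be]]) auto
    have eq: "AE \<omega> in M. \<omega> \<notin> ?W \<longrightarrow> Z s \<omega> = ?Y \<omega>"
      using AE_path AE_Z AE_space
    proof eventually_elim
      case (elim \<omega>)
      interpret contact_path n x0 "\<lambda>e t. N e t \<omega>" "\<lambda>t. X t \<omega>" by fact
      show ?case
      proof
        assume "\<omega> \<notin> ?W"
        with elim have nc: "\<not> crowded n (incr (\<tau> j) (\<tau> (Suc j)) \<omega>)" if "j < ?k" for j
          using that by (auto simp: grid_crowded_def \<tau>_def)
        have "X (\<tau> ?k) \<omega> = ?Y \<omega>"
          unfolding incr_def by (rule at_grid[OF \<tau>0 inc]) (use nc in \<open>simp add: incr_def[abs_def]\<close>)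
        with elim st show "Z s \<omega> = ?Y \<omega>" by (simp add: \<tau>k)
      qed
    qed
    have 1: "\<bar>?ZB - prob {\<omega>\<in>space M. ?Y \<omega> \<in> A \<and> B (incr s t \<omega>)}\<bar> \<le> prob ?W"
      by (rule close) (use ZBe YBe st eq in auto)
    have 2: "\<bar>?Z - prob {\<omega>\<in>space M. ?Y \<omega> \<in> A}\<bar> \<le> prob ?W"
      by (rule close) (use Ze Ye st eq in auto)
    have 3: "prob {\<omega>\<in>space M. ?Y \<omega> \<in> A \<and> B (incr s t \<omega>)} = prob {\<omega>\<in>space M. ?Y \<omega> \<in> A} * ?B"
      using prob_chain_incr[of \<tau> B ?k x0 A, OF _ inc B] by (simp add: \<tau>0 \<tau>k)
    have "\<bar>?Z * ?B - prob {\<omega>\<in>space M. ?Y \<omega> \<in> A} * ?B\<bar> = \<bar>?Z - prob {\<omega>\<in>space M. ?Y \<omega> \<in> A}\<bar> * ?B"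
      by (simp add: abs_mult left_diff_distrib[symmetric])
    also have "\<dots> \<le> prob ?W * 1" using 2 by (intro mult_mono) auto
    finally have "\<bar>?ZB - ?Z * ?B\<bar> \<le> 2 * prob ?W" using 1 3 by linarith
    also have "\<dots> \<le> 2 * ((total_rate * s)\<^sup>2 / real (Suc k))"
      using prob_grid_crowded[OF st(1), of ?k] by simp
    finally show ?thesis .
  qed
  moreover have "(\<lambda>k. 2 * ((total_rate * s)\<^sup>2 / real (Suc k))) \<longlonglongrightarrow> 2 * 0"
    by (intro tendsto_mult tendsto_const LIMSEQ_Suc lim_const_over_n)
  ultimately have "\<bar>?ZB - ?Z * ?B\<bar> \<le> 2 * 0" by (intro LIMSEQ_le_const) auto
  then show ?thesis by simp
qed

end

context driven_consensus begin

section \<open>Expected hitting times from the generator\<close>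

lemma Z_sum:
  fixes \<phi> :: "config \<Rightarrow> real"
  assumes "\<omega> \<in> space M"
  shows "\<phi> (Z s \<omega>) = (\<Sum>x\<in>configs. \<phi> x * indicator {\<omega>\<in>space M. Z s \<omega> \<in> {x}} \<omega>)"
proof -
  have "(\<Sum>x\<in>configs. \<phi> x * indicator {\<omega>\<in>space M. Z s \<omega> \<in> {x}} \<omega>) = (\<Sum>x\<in>configs. if Z s \<omega> = x then \<phi> x else 0)"
    using assms by (intro sum.cong) (auto simp: indicator_def)
  also have "\<dots> = \<phi> (Z s \<omega>)" using finite_configs Z_configs by simp
  finally show ?thesis by simp
qed

lemma Z_bounded: "\<exists>K\<ge>0. \<forall>s \<omega>. \<bar>\<phi> (Z s \<omega>) :: real\<bar> \<le> K"
proof (intro exI conjI allI)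
  show "0 \<le> (\<Sum>x\<in>configs. \<bar>\<phi> x\<bar>)" by (simp add: sum_nonneg)
  show "\<bar>\<phi> (Z s \<omega>)\<bar> \<le> (\<Sum>x\<in>configs. \<bar>\<phi> x\<bar>)" for s \<omega>
    by (rule member_le_sum) (use finite_configs Z_configs in auto)
qed

lemma Z_integrable:
  assumes "0 \<le> s" shows "integrable M (\<lambda>\<omega>. \<phi> (Z s \<omega>) :: real)"
proof -
  obtain K where "\<forall>\<omega>. \<bar>\<phi> (Z s \<omega>)\<bar> \<le> K" using Z_bounded[of \<phi>] by blast
  then show ?thesis
    by (intro integrable_const_bound[where B=K]) (auto intro: measurable_compose[OF Z_measurable[OF assms]])
qed

lemma expectation_Z_incr:
  fixes \<phi> :: "config \<Rightarrow> real"
  assumes st: "0 \<le> s" "s \<le> t"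
    and B: "\<And>v w. (\<And>e. e \<in> node_pairs n \<Longrightarrow> v e = w e) \<Longrightarrow> B v = B w"
  shows "(\<integral>\<omega>. \<phi> (Z s \<omega>) * indicator {\<omega>\<in>space M. B (incr s t \<omega>)} \<omega> \<partial>M) =
    (\<integral>\<omega>. \<phi> (Z s \<omega>) \<partial>M) * prob {\<omega>\<in>space M. B (incr s t \<omega>)}"
proof -
  let ?B = "{\<omega>\<in>space M. B (incr s t \<omega>)}" and ?Z = "\<lambda>x. {\<omega>\<in>space M. Z s \<omega> \<in> {x}}"
  have Be: "?B \<in> events" using st by (intro incr_event B) auto
  have Ze: "?Z x \<in> events" for x using st by (intro Z_event)
  define U where "U x = ?Z x \<inter> ?B" for x
  have Ue: "U x \<in> events" for x unfolding U_def using Ze Be by (rule sets.Int)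
  have inter: "U x = {\<omega>\<in>space M. Z s \<omega> \<in> {x} \<and> B (incr s t \<omega>)}" for x by (auto simp: U_def)
  have "(\<integral>\<omega>. \<phi> (Z s \<omega>) * indicator ?B \<omega> \<partial>M) = (\<integral>\<omega>. (\<Sum>x\<in>configs. \<phi> x * indicator (U x) \<omega>) \<partial>M)"
    by (rule Bochner_Integration.integral_cong)
       (simp_all add: Z_sum[of _ \<phi>] sum_distrib_right indicator_inter_arith mult.assoc U_def)
  also have "\<dots> = (\<Sum>x\<in>configs. \<phi> x * prob (U x))"
    using Ue by (subst Bochner_Integration.integral_sum)
      (auto intro!: integrable_mult_right integrable_real_indicator simp: less_top[symmetric])
  also have "\<dots> = (\<Sum>x\<in>configs. \<phi> x * prob (?Z x)) * prob ?B"
  proof -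
    have "prob (U x) = prob (?Z x) * prob ?B" for x
      unfolding inter by (rule prob_Z_incr[OF st]) (rule B)
    then show ?thesis by (simp add: sum_distrib_right mult.assoc)
  qed
  also have "(\<Sum>x\<in>configs. \<phi> x * prob (?Z x)) = (\<integral>\<omega>. (\<Sum>x\<in>configs. \<phi> x * indicator (?Z x) \<omega>) \<partial>M)"
    using Ze by (subst Bochner_Integration.integral_sum)
      (auto intro!: integrable_mult_right integrable_real_indicator simp: less_top[symmetric] simp del: singleton_iff)
  also have "\<dots> = (\<integral>\<omega>. \<phi> (Z s \<omega>) \<partial>M)"
    by (rule Bochner_Integration.integral_cong) (simp_all add: Z_sum[of _ \<phi>])
  finally show ?thesis .
qed

end

text \<open>The function \<open>f\<close> is the candidate for the expected time to hit \<open>D\<close> from a state in the invariant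
set \<open>C\<close>.  The last assumption is the first-step equation: outside \<open>D\<close>, the generator
maps \<open>f\<close> to \<open>- 1\<close>.\<close>

locale consensus_hitting = driven_consensus +
  fixes C D :: "config set" and f :: "config \<Rightarrow> real"
  assumes x0_C: "x0 \<in> C" and C_closed: "contact_closed n C" and D_closed: "contact_closed n D"
    and f_nonneg: "x \<in> C \<Longrightarrow> 0 \<le> f x" and f_D: "x \<in> C \<Longrightarrow> x \<in> D \<Longrightarrow> f x = 0"
    and generator: "x \<in> C \<Longrightarrow> x \<notin> D \<Longrightarrow>
      (\<Sum>e\<in>node_pairs n. case_prod Q e * (f x - f (case_prod contact e x))) = 1"
begin

lemma AE_Z_C: "AE \<omega> in M. \<forall>t\<ge>0. Z t \<omega> \<in> C"
  using AE_stays AE_path AE_Z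
proof eventually_elim
  case (elim \<omega>)
  have "X 0 \<omega> \<in> C" using contact_path.start[OF elim(2)] x0_C by simp
  then show ?case using elim C_closed by (metis order_refl)
qed

lemma AE_Z_D: "AE \<omega> in M. \<forall>s t. 0 \<le> s \<longrightarrow> s \<le> t \<longrightarrow> Z s \<omega> \<in> D \<longrightarrow> Z t \<omega> \<in> D"
  using AE_stays AE_Z
proof eventually_elim
  case (elim \<omega>)
  then show ?case using D_closed by (metis order.trans)
qed

definition f_max :: real where
  "f_max = (SOME K. 0 \<le> K \<and> (\<forall>s \<omega>. \<bar>f (Z s \<omega>)\<bar> \<le> K))"

lemma f_bound: "0 \<le> f_max" "\<bar>f (Z s \<omega>)\<bar> \<le> f_max"
  using someI_ex[OF Z_bounded[of f]] unfolding f_max_def by auto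

definition survival :: "real \<Rightarrow> real" where
  "survival s = prob {\<omega>\<in>space M. Z s \<omega> \<notin> D}"

definition mean_f :: "real \<Rightarrow> real" where
  "mean_f s = (\<integral>\<omega>. f (Z s \<omega>) \<partial>M)"

lemma survival_event: "0 \<le> s \<Longrightarrow> {\<omega>\<in>space M. Z s \<omega> \<notin> D} \<in> events"
  using Z_event[of s "- D"] by simp

lemma survival_eq: "0 \<le> s \<Longrightarrow> survival s = (\<integral>\<omega>. of_bool (Z s \<omega> \<notin> D) \<partial>M)"
proof -
  assume s: "0 \<le> s"
  have "(\<integral>\<omega>. of_bool (Z s \<omega> \<notin> D) \<partial>M) = (\<integral>\<omega>. indicator {\<omega>\<in>space M. Z s \<omega> \<notin> D} \<omega> \<partial>M :: real)"
    by (rule Bochner_Integration.integral_cong) auto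
  with survival_event[OF s] show ?thesis by (simp add: survival_def)
qed

lemma contact_CD: "x \<in> C \<Longrightarrow> x \<in> D \<Longrightarrow> e \<in> node_pairs n \<Longrightarrow> f (case_prod contact e x) = 0"
  using C_closed D_closed by (intro f_D) (auto simp: contact_closed_def)

lemma mean_f_le: "0 \<le> s \<Longrightarrow> mean_f s \<le> f_max * survival s"
proof -
  assume s: "0 \<le> s"
  have "mean_f s \<le> (\<integral>\<omega>. f_max * of_bool (Z s \<omega> \<notin> D) \<partial>M)"
    unfolding mean_f_def
  proof (rule integral_mono_AE)
    show "AE \<omega> in M. f (Z s \<omega>) \<le> f_max * of_bool (Z s \<omega> \<notin> D)"
      using AE_Z_C
    proof eventually_elim
      case (elim \<omega>)
      then show ?case using f_bound(2)[of s \<omega>] f_D[of "Z s \<omega>"] s by (cases "Z s \<omega> \<in> D") auto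
    qed
  qed (use s Z_integrable[of s "\<lambda>x. f_max * of_bool (x \<notin> D)"] Z_integrable in auto)
  then show ?thesis by (simp add: survival_eq[OF s])
qed

lemma mean_f_nonneg: "0 \<le> s \<Longrightarrow> 0 \<le> mean_f s"
  unfolding mean_f_def
  by (rule integral_nonneg_AE) (use AE_Z_C f_nonneg in \<open>auto elim!: eventually_mono\<close>)

lemma mean_f_0: "mean_f 0 = f x0"
proof -
  have "AE \<omega> in M. f (Z 0 \<omega>) = f x0"
    using AE_path AE_Z
  proof eventually_elim
    case (elim \<omega>)
    then show ?case using contact_path.start[OF elim(1)] by simp
  qed
  then have "mean_f 0 = (\<integral>\<omega>. f x0 \<partial>M)"
    unfolding mean_f_def
    by (intro integral_cong_AE borel_measurable_integrable[OF Z_integrable]) auto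
  then show ?thesis by (simp add: prob_space)
qed

text \<open>A discrete form of Dynkin's formula.  Over a short period, a single contact contributes the
generator applied to \<open>f\<close>, which is \<open>- 1\<close> before the hitting time; crowded periods contribute an error of second
order.  The error bound carries the factor \<open>survival s\<close>, because nothing changes after the hitting
time; this makes the errors summable over an unbounded horizon.\<close>

lemma one_step:
  assumes st: "0 \<le> s" "s < t"
  shows "\<bar>mean_f s - mean_f t - (t - s) * exp (- (total_rate * (t - s))) * survival s\<bar> \<le>
    f_max * (total_rate * (t - s))\<^sup>2 * survival s"
proof -
  from st have st': "s \<le> t" "0 \<le> t" by auto
  let ?P = "node_pairs n"
  let ?S = "\<lambda>e. {\<omega>\<in>space M. only_at n e (incr s t \<omega>)}" and ?K = "{\<omega>\<in>space M. crowded n (incr s t \<omega>)}"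
  define g where "g e x = f x - f (case_prod contact e x)" for e x
  define R where "R \<omega> = (f (Z s \<omega>) - f (Z t \<omega>)) * indicator ?K \<omega>" for \<omega>
  have Ke: "?K \<in> events" and Se: "\<And>e. ?S e \<in> events"
    using st st' by (auto intro!: crowded_event only_at_event)
  have gint: "integrable M (\<lambda>\<omega>. g e (Z s \<omega>) * indicator (?S e) \<omega>)" for e
    using Se Z_integrable[OF st(1)] by (intro integrable_real_mult_indicator)
  have Rint: "integrable M R"
    unfolding R_def using Ke st st'
    by (intro integrable_real_mult_indicator Bochner_Integration.integrable_diff Z_integrable) auto
  have split: "AE \<omega> in M. f (Z s \<omega>) - f (Z t \<omega>) = (\<Sum>e\<in>?P. g e (Z s \<omega>) * indicator (?S e) \<omega>) + R \<omega>"
    using AE_path AE_Z AE_space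
  proof eventually_elim
    case (elim \<omega>)
    interpret contact_path n x0 "\<lambda>e t. N e t \<omega>" "\<lambda>t. X t \<omega>" by fact
    have Zst: "Z s \<omega> = X s \<omega>" "Z t \<omega> = X t \<omega>" using elim st st' by auto
    show ?case
    proof (cases "crowded n (incr s t \<omega>)")
      case True
      then have "\<not> only_at n e (incr s t \<omega>)" for e using crowded_iff by blast
      then have "(\<Sum>e\<in>?P. g e (Z s \<omega>) * indicator (?S e) \<omega>) = 0" by (intro sum.neutral) auto
      with True elim show ?thesis by (simp add: R_def)
    next
      case False
      then have jump: "Z t \<omega> = jump n (incr s t \<omega>) (Z s \<omega>)"
        unfolding Zst incr_def[abs_def] using st st' by (intro step) (simp_all add: incr_def[abs_def])
      have R0: "R \<omega> = 0" using False by (simp add: R_def)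
      consider (q) "quiet n (incr s t \<omega>)" | (s) e where "only_at n e (incr s t \<omega>)"
        using False crowded_iff by blast
      then show ?thesis
      proof cases
        case q
        then have "\<not> only_at n e (incr s t \<omega>)" for e using not_quiet_only_at by blast
        then have "(\<Sum>e\<in>?P. g e (Z s \<omega>) * indicator (?S e) \<omega>) = 0" by (intro sum.neutral) auto
        with q show ?thesis by (simp add: R0 jump jump_quiet)
      next
        case (s e)
        then have e: "e \<in> ?P" by (simp add: only_at_def)
        have "(\<Sum>e'\<in>?P. g e' (Z s \<omega>) * indicator (?S e') \<omega>) = (\<Sum>e'\<in>?P. if e' = e then g e (Z s \<omega>) else 0)"
        proof (rule sum.cong)
          fix e' assume "e' \<in> ?P"
          show "g e' (Z s \<omega>) * indicator (?S e') \<omega> = (if e' = e then g e (Z s \<omega>) else 0)"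
          proof (cases "e' = e")
            case True
            with s elim show ?thesis by simp
          next
            case False
            then have "\<not> only_at n e' (incr s t \<omega>)" using only_at_unique[OF s] by blast
            with False show ?thesis by simp
          qed
        qed simp
        also have "\<dots> = g e (Z s \<omega>)" using e by simp
        finally show ?thesis using s by (simp add: R0 jump jump_only_at g_def)
      qed
    qed
  qed
  have "mean_f s - mean_f t = (\<integral>\<omega>. f (Z s \<omega>) - f (Z t \<omega>) \<partial>M)"
    unfolding mean_f_def using st st' by (simp add: Z_integrable)
  also have "\<dots> = (\<integral>\<omega>. (\<Sum>e\<in>?P. g e (Z s \<omega>) * indicator (?S e) \<omega>) + R \<omega> \<partial>M)"
  proof (rule integral_cong_AE[OF _ _ split]; rule borel_measurable_integrable)
    show "integrable M (\<lambda>\<omega>. f (Z s \<omega>) - f (Z t \<omega>))"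
      using st st' by (intro Bochner_Integration.integrable_diff Z_integrable)
    show "integrable M (\<lambda>\<omega>. (\<Sum>e\<in>?P. g e (Z s \<omega>) * indicator (?S e) \<omega>) + R \<omega>)"
      by (intro Bochner_Integration.integrable_add Bochner_Integration.integrable_sum gint Rint)
  qed
  also have "\<dots> = (\<Sum>e\<in>?P. \<integral>\<omega>. g e (Z s \<omega>) * indicator (?S e) \<omega> \<partial>M) + (\<integral>\<omega>. R \<omega> \<partial>M)"
    unfolding Bochner_Integration.integral_sum[OF gint, symmetric]
    by (intro Bochner_Integration.integral_add Bochner_Integration.integrable_sum gint Rint)
  also have "(\<Sum>e\<in>?P. \<integral>\<omega>. g e (Z s \<omega>) * indicator (?S e) \<omega> \<partial>M) =
    (\<Sum>e\<in>?P. (\<integral>\<omega>. g e (Z s \<omega>) \<partial>M) * (case_prod Q e * (t - s) * exp (- (total_rate * (t - s)))))"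
  proof (intro sum.cong refl)
    fix e assume e: "e \<in> ?P"
    have "(\<integral>\<omega>. g e (Z s \<omega>) * indicator (?S e) \<omega> \<partial>M) = (\<integral>\<omega>. g e (Z s \<omega>) \<partial>M) * prob (?S e)"
      by (rule expectation_Z_incr[OF st(1) st'(1)]) (rule only_at_cong)
    then show "(\<integral>\<omega>. g e (Z s \<omega>) * indicator (?S e) \<omega> \<partial>M) =
      (\<integral>\<omega>. g e (Z s \<omega>) \<partial>M) * (case_prod Q e * (t - s) * exp (- (total_rate * (t - s))))"
      by (simp only: prob_only_at[OF st e])
  qed
  also have "\<dots> = (t - s) * exp (- (total_rate * (t - s))) * (\<integral>\<omega>. (\<Sum>e\<in>?P. case_prod Q e * g e (Z s \<omega>)) \<partial>M)"
    using Z_integrable[OF st(1)]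
    by (subst Bochner_Integration.integral_sum) (auto simp: sum_distrib_left mult_ac)
  also have "(\<integral>\<omega>. (\<Sum>e\<in>?P. case_prod Q e * g e (Z s \<omega>)) \<partial>M) = survival s"
    unfolding survival_eq[OF st(1)]
  proof (rule integral_cong_AE)
    show "AE \<omega> in M. (\<Sum>e\<in>?P. case_prod Q e * g e (Z s \<omega>)) = of_bool (Z s \<omega> \<notin> D)"
      using AE_Z_C
    proof eventually_elim
      case (elim \<omega>)
      with st have C: "Z s \<omega> \<in> C" by auto
      show ?case
      proof (cases "Z s \<omega> \<in> D")
        case True
        with C show ?thesis by (simp add: g_def contact_CD f_D)
      next
        case False
        with C generator show ?thesis by (simp add: g_def)
      qed
    qed
    show "(\<lambda>\<omega>. \<Sum>e\<in>?P. case_prod Q e * g e (Z s \<omega>)) \<in> borel_measurable M"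
      by (rule borel_measurable_integrable, rule Z_integrable[OF st(1)])
    show "(\<lambda>\<omega>. of_bool (Z s \<omega> \<notin> D) :: real) \<in> borel_measurable M"
      by (rule borel_measurable_integrable, rule Z_integrable[OF st(1)])
  qed
  finally have eq: "mean_f s - mean_f t = (t - s) * exp (- (total_rate * (t - s))) * survival s + (\<integral>\<omega>. R \<omega> \<partial>M)" .
  have "\<bar>\<integral>\<omega>. R \<omega> \<partial>M\<bar> \<le> (\<integral>\<omega>. \<bar>R \<omega>\<bar> \<partial>M)" by (rule integral_abs_bound)
  also have "\<dots> \<le> (\<integral>\<omega>. (f_max * of_bool (Z s \<omega> \<notin> D)) * indicator ?K \<omega> \<partial>M)"
  proof (rule integral_mono_AE)
    show "AE \<omega> in M. \<bar>R \<omega>\<bar> \<le> (f_max * of_bool (Z s \<omega> \<notin> D)) * indicator ?K \<omega>"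
      using AE_Z_C AE_Z_D
    proof eventually_elim
      case (elim \<omega>)
      have C: "Z s \<omega> \<in> C" "Z t \<omega> \<in> C" using elim st st' by auto
      have "\<bar>f (Z s \<omega>) - f (Z t \<omega>)\<bar> \<le> f_max * of_bool (Z s \<omega> \<notin> D)"
      proof (cases "Z s \<omega> \<in> D")
        case True
        with elim st st' have "Z t \<omega> \<in> D" by blast
        with True C show ?thesis by (simp add: f_D)
      next
        case False
        have "0 \<le> f (Z s \<omega>)" "0 \<le> f (Z t \<omega>)" using C f_nonneg by auto
        then show ?thesis using False f_bound(2)[of s \<omega>] f_bound(2)[of t \<omega>] by auto
      qed
      then show ?case by (auto simp: R_def indicator_def)
    qed
    show "integrable M (\<lambda>\<omega>. \<bar>R \<omega>\<bar>)" using Rint by simp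
    show "integrable M (\<lambda>\<omega>. (f_max * of_bool (Z s \<omega> \<notin> D)) * indicator ?K \<omega>)"
      by (rule integrable_real_mult_indicator[OF Ke]) (rule Z_integrable[OF st(1)])
  qed
  also have "\<dots> = (\<integral>\<omega>. f_max * of_bool (Z s \<omega> \<notin> D) \<partial>M) * prob ?K"
    by (rule expectation_Z_incr[OF st(1) st'(1), where \<phi>="\<lambda>x. f_max * of_bool (x \<notin> D)"]) (rule crowded_cong)
  also have "\<dots> = f_max * survival s * prob ?K" by (simp add: survival_eq[OF st(1)])
  also have "\<dots> \<le> f_max * survival s * (total_rate * (t - s))\<^sup>2"
    using f_bound(1) by (intro mult_left_mono prob_crowded st st') (auto simp: survival_def)
  finally show ?thesis unfolding eq by (simp add: mult_ac)
qed

definition hitting_time :: "'a \<Rightarrow> ennreal" where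
  "hitting_time \<omega> = (INF t\<in>{t. 0 \<le> t \<and> X t \<omega> \<in> D}. ennreal t)"

lemma hitting_time_le_grid:
  assumes h: "0 < h" and Z: "\<forall>t\<ge>0. Z t \<omega> = X t \<omega>" and sp: "\<omega> \<in> space M"
  shows "hitting_time \<omega> \<le> (\<Sum>j. ennreal h * indicator {\<omega>\<in>space M. Z (real j * h) \<omega> \<notin> D} \<omega>)"
proof (cases "\<exists>j::nat. Z (real j * h) \<omega> \<in> D")
  case True
  define J where "J = (LEAST j::nat. Z (real j * h) \<omega> \<in> D)"
  have J: "Z (real J * h) \<omega> \<in> D" unfolding J_def using True by (rule LeastI_ex)
  have before: "Z (real j * h) \<omega> \<notin> D" if "j < J" for j using not_less_Least that unfolding J_def by blast
  have "hitting_time \<omega> \<le> ennreal (real J * h)"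
    unfolding hitting_time_def using J Z h by (intro INF_lower) auto
  also have "\<dots> = (\<Sum>j<J. ennreal h)"
    using h by (simp add: ennreal_mult ennreal_of_nat_eq_real_of_nat)
  also have "\<dots> = (\<Sum>j<J. ennreal h * indicator {\<omega>\<in>space M. Z (real j * h) \<omega> \<notin> D} \<omega>)"
    using before sp by (intro sum.cong) auto
  also have "\<dots> \<le> (\<Sum>j. ennreal h * indicator {\<omega>\<in>space M. Z (real j * h) \<omega> \<notin> D} \<omega>)"
    by (rule sum_le_suminf) auto
  finally show ?thesis .
next
  case False
  have "(\<Sum>j. ennreal h * indicator {\<omega>\<in>space M. Z (real j * h) \<omega> \<notin> D} \<omega>) = (\<Sum>j::nat. ennreal h)"
    using False sp by simp
  also have "\<dots> = \<top>"
  proof (rule ccontr)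
    assume "(\<Sum>j::nat. ennreal h) \<noteq> \<top>"
    then have "summable (\<lambda>_::nat. h)" by (rule summable_suminf_not_top[rotated]) (use h in simp)
    then show False using h by (simp add: summable_const_iff)
  qed
  finally show ?thesis by simp
qed

lemma grid_le_hitting_time:
  assumes h: "0 < h" and Z: "\<forall>t\<ge>0. Z t \<omega> = X t \<omega>"
    and D: "\<forall>s t. 0 \<le> s \<longrightarrow> s \<le> t \<longrightarrow> Z s \<omega> \<in> D \<longrightarrow> Z t \<omega> \<in> D"
  shows "(\<Sum>j. ennreal h * indicator {\<omega>\<in>space M. Z (real (Suc j) * h) \<omega> \<notin> D} \<omega>) \<le> hitting_time \<omega>"
  unfolding hitting_time_def
proof (rule INF_greatest, safe)
  fix t :: real assume t: "0 \<le> t" "X t \<omega> \<in> D"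
  define m where "m = nat \<lfloor>t / h\<rfloor>"
  let ?a = "\<lambda>j. ennreal h * indicator {\<omega>\<in>space M. Z (real (Suc j) * h) \<omega> \<notin> D} \<omega>"
  have "?a j = 0" if "j \<notin> {..<m}" for j
  proof -
    have "t / h < real m + 1" unfolding m_def by linarith
    also have "\<dots> \<le> real (Suc j)" using that by simp
    finally have "t \<le> real (Suc j) * h" using h by (simp add: field_simps)
    with D[rule_format, of t "real (Suc j) * h"] Z t show ?thesis by auto
  qed
  then have "(\<Sum>j. ?a j) = (\<Sum>j<m. ?a j)" by (intro suminf_finite) auto
  also have "\<dots> \<le> (\<Sum>j<m. ennreal h)" by (intro sum_mono) (auto simp: indicator_def)
  also have "\<dots> = ennreal (real m * h)"
    using h by (simp add: ennreal_mult ennreal_of_nat_eq_real_of_nat)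
  also have "real m * h \<le> t"
  proof -
    have "real m \<le> t / h" unfolding m_def using t h by simp
    then show ?thesis using h by (simp add: field_simps)
  qed
  then have "ennreal (real m * h) \<le> ennreal t" by (rule ennreal_leI)
  finally show "(\<Sum>j. ?a j) \<le> ennreal t" .
qed

lemma nn_integral_grid:
  assumes h: "0 < h" and nn: "\<And>j. 0 \<le> s j" and sum: "(\<lambda>j. survival (s j)) sums S"
  shows "(\<integral>\<^sup>+\<omega>. (\<Sum>j. ennreal h * indicator {\<omega>\<in>space M. Z (s j) \<omega> \<notin> D} \<omega>) \<partial>M) = ennreal (h * S)"
proof -
  have "(\<integral>\<^sup>+\<omega>. (\<Sum>j. ennreal h * indicator {\<omega>\<in>space M. Z (s j) \<omega> \<notin> D} \<omega>) \<partial>M) =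
      (\<Sum>j. \<integral>\<^sup>+\<omega>. ennreal h * indicator {\<omega>\<in>space M. Z (s j) \<omega> \<notin> D} \<omega> \<partial>M)"
    using survival_event[OF nn] by (intro nn_integral_suminf) auto
  also have "\<dots> = (\<Sum>j. ennreal (h * survival (s j)))"
    using survival_event[OF nn] h
    by (simp add: nn_integral_cmult_indicator emeasure_eq_measure survival_def ennreal_mult)
  also have "\<dots> = ennreal (h * S)"
    using sums_mult[OF sum, of h] h
    by (subst suminf_ennreal2) (auto simp: survival_def sums_iff)
  finally show ?thesis .
qed

text \<open>Summing the one-step estimate over a grid of mesh \<open>h\<close> on the whole half-line bounds the sum of the
survival probabilities at the grid points in terms of \<open>f x0\<close>: convergence of that sum also shows that
the mean of \<open>f\<close> tends to 0.  Times \<open>h\<close>, this sum is the expected hitting time up to \<open>h\<close>.  The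
hitting time is compared with sums of indicators pointwise, so its measurability is never at issue.\<close>

lemma mesh_bounds:
  assumes h: "0 < h" and pos: "0 < exp (- (total_rate * h)) - f_max * total_rate\<^sup>2 * h"
  shows "(\<integral>\<^sup>+\<omega>. hitting_time \<omega> \<partial>M) \<le> ennreal (f x0 / (exp (- (total_rate * h)) - f_max * total_rate\<^sup>2 * h))"
    and "ennreal (f x0 / (exp (- (total_rate * h)) + f_max * total_rate\<^sup>2 * h) - h) \<le> (\<integral>\<^sup>+\<omega>. hitting_time \<omega> \<partial>M)"
proof -
  define a where "a = exp (- (total_rate * h))"
  define b where "b = f_max * total_rate\<^sup>2 * h"
  define p where "p j = survival (real j * h)" for j :: nat
  define u where "u j = mean_f (real j * h)" for j :: nat
  have b: "0 \<le> b" and a: "0 < a" and ab: "0 < a - b" using f_bound(1) h pos by (auto simp: a_def b_def)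
  have p: "0 \<le> p j" "p j \<le> 1" for j by (auto simp: p_def survival_def)
  have u: "0 \<le> u j" "u j \<le> f_max * p j" for j using mean_f_nonneg mean_f_le h by (auto simp: u_def p_def)
  have u0: "u 0 = f x0" by (simp add: u_def mean_f_0)
  have step: "h * (a - b) * p j \<le> u j - u (Suc j)" "u j - u (Suc j) \<le> h * (a + b) * p j" for j
  proof -
    have "real (Suc j) * h - real j * h = h" by (simp add: algebra_simps)
    with one_step[of "real j * h" "real (Suc j) * h"] h
    have "\<bar>u j - u (Suc j) - h * a * p j\<bar> \<le> f_max * (total_rate * h)\<^sup>2 * p j"
      by (simp add: u_def p_def a_def)
    also have "f_max * (total_rate * h)\<^sup>2 * p j = h * b * p j" by (simp add: b_def power2_eq_square)
    finally show "h * (a - b) * p j \<le> u j - u (Suc j)" "u j - u (Suc j) \<le> h * (a + b) * p j"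
      by (auto simp: abs_le_iff left_diff_distrib right_diff_distrib distrib_left distrib_right)
  qed
  have tele: "(\<Sum>j<k. u j - u (Suc j)) = f x0 - u k" for k
    by (simp add: sum_lessThan_telescope' u0)
  have low: "h * (a - b) * (\<Sum>j<k. p j) \<le> f x0 - u k" for k
    unfolding tele[symmetric] sum_distrib_left by (intro sum_mono step)
  have up: "f x0 - u k \<le> h * (a + b) * (\<Sum>j<k. p j)" for k
    unfolding tele[symmetric] sum_distrib_left by (intro sum_mono step)
  have hab: "0 < h * (a - b)" using h ab by simp
  have bound: "(\<Sum>j<k. p j) \<le> f x0 / (h * (a - b))" for k
  proof -
    have "h * (a - b) * (\<Sum>j<k. p j) \<le> f x0" using low[of k] u(1)[of k] by linarith
    then show ?thesis using hab by (simp add: field_simps)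
  qed
  have summ: "summable p" by (rule summableI_nonneg_bounded[OF p(1) bound])
  define S where "S = suminf p"
  have S: "p sums S" using summ by (simp add: S_def summable_sums)
  have upS: "S \<le> f x0 / (h * (a - b))"
    unfolding S_def by (rule suminf_le_const[OF summ bound])
  have "u \<longlonglongrightarrow> 0"
  proof (rule tendsto_sandwich[of "\<lambda>_. 0" u _ "\<lambda>j. f_max * p j"])
    show "(\<lambda>j. f_max * p j) \<longlonglongrightarrow> 0" using tendsto_mult_right_zero[OF summable_LIMSEQ_zero[OF summ]] .
  qed (use u in auto)
  then have "(\<lambda>k. f x0 - u k) \<longlonglongrightarrow> f x0 - 0" by (intro tendsto_intros)
  moreover have "f x0 - u k \<le> h * (a + b) * S" for k
  proof -
    have "(\<Sum>j<k. p j) \<le> S" unfolding S_def by (rule sum_le_suminf[OF summ]) (auto intro: p)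
    then have "h * (a + b) * (\<Sum>j<k. p j) \<le> h * (a + b) * S" using h a b by (intro mult_left_mono) auto
    with up[of k] show ?thesis by linarith
  qed
  ultimately have "f x0 \<le> h * (a + b) * S" using LIMSEQ_le_const2 by fastforce
  then have lowS: "f x0 / (a + b) \<le> h * S" using a b by (simp add: field_simps)
  have "(\<integral>\<^sup>+\<omega>. hitting_time \<omega> \<partial>M) \<le> (\<integral>\<^sup>+\<omega>. (\<Sum>j. ennreal h * indicator {\<omega>\<in>space M. Z (real j * h) \<omega> \<notin> D} \<omega>) \<partial>M)"
    by (rule nn_integral_mono_AE) (use AE_Z AE_space in eventually_elim, rule hitting_time_le_grid[OF h])
  also have "\<dots> = ennreal (h * S)" by (rule nn_integral_grid[OF h]) (use h S[unfolded p_def[abs_def]] in auto)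
  also have "\<dots> \<le> ennreal (f x0 / (a - b))"
    using upS h ab by (intro ennreal_leI) (simp add: field_simps)
  finally show "(\<integral>\<^sup>+\<omega>. hitting_time \<omega> \<partial>M) \<le> ennreal (f x0 / (exp (- (total_rate * h)) - f_max * total_rate\<^sup>2 * h))"
    by (simp add: a_def b_def)
  have "f x0 / (a + b) - h \<le> h * (S - p 0)"
  proof -
    have "h * p 0 \<le> h" using mult_left_mono[OF p(2)[of 0], of h] h by simp
    then show ?thesis using lowS by (simp add: right_diff_distrib)
  qed
  then have "ennreal (f x0 / (a + b) - h) \<le> ennreal (h * (S - p 0))" by (rule ennreal_leI)
  also have "\<dots> = (\<integral>\<^sup>+\<omega>. (\<Sum>j. ennreal h * indicator {\<omega>\<in>space M. Z (real (Suc j) * h) \<omega> \<notin> D} \<omega>) \<partial>M)"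
    by (rule nn_integral_grid[OF h, symmetric])
       (use h S in \<open>auto simp: sums_Suc_iff p_def[symmetric] simp del: of_nat_Suc\<close>)
  also have "\<dots> \<le> (\<integral>\<^sup>+\<omega>. hitting_time \<omega> \<partial>M)"
    by (rule nn_integral_mono_AE) (use AE_Z AE_Z_D in eventually_elim, rule grid_le_hitting_time[OF h])
  finally show "ennreal (f x0 / (exp (- (total_rate * h)) + f_max * total_rate\<^sup>2 * h) - h) \<le> (\<integral>\<^sup>+\<omega>. hitting_time \<omega> \<partial>M)"
    by (simp add: a_def b_def)
qed

lemma expected_hitting_time: "(\<integral>\<^sup>+\<omega>. hitting_time \<omega> \<partial>M) = ennreal (f x0)"
proof -
  let ?T = "\<integral>\<^sup>+\<omega>. hitting_time \<omega> \<partial>M"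
  let ?a = "\<lambda>h. exp (- (total_rate * h))" and ?b = "\<lambda>h. f_max * total_rate\<^sup>2 * h"
  have lim_d: "((\<lambda>h. ?a h - ?b h) \<longlongrightarrow> 1) (at_right 0)" and lim_s: "((\<lambda>h. ?a h + ?b h) \<longlongrightarrow> 1) (at_right 0)"
    by (auto intro!: tendsto_eq_intros)
  have pos: "\<forall>\<^sub>F h in at_right 0. 0 < ?a h - ?b h" using order_tendstoD(1)[OF lim_d, of 0] by simp
  have h: "\<forall>\<^sub>F h in at_right 0. (0::real) < h" by (rule eventually_at_right_less)
  have "?T \<noteq> \<top>"
  proof -
    have "\<exists>h. 0 < h \<and> 0 < ?a h - ?b h"
      using eventually_happens[OF eventually_conj[OF h pos]] by (simp add: trivial_limit_at_right_real)
    then show ?thesis using mesh_bounds(1) by (metis ennreal_less_top leD top.not_eq_extremum)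
  qed
  then obtain r where r: "?T = ennreal r" "0 \<le> r" by (cases ?T) auto
  have fx: "0 \<le> f x0" by (rule f_nonneg[OF x0_C])
  have "r \<le> f x0"
  proof (rule tendsto_lowerbound)
    show "((\<lambda>h. f x0 / (?a h - ?b h)) \<longlongrightarrow> f x0) (at_right 0)"
      using tendsto_divide[OF tendsto_const lim_d, of "f x0"] by simp
    show "\<forall>\<^sub>F h in at_right 0. r \<le> f x0 / (?a h - ?b h)"
      using h pos
    proof eventually_elim
      case (elim h)
      from mesh_bounds(1)[OF this] show ?case
        using r fx elim by (simp add: ennreal_le_iff2) (smt (verit) divide_nonneg_pos)
    qed
  qed simp
  moreover have "f x0 \<le> r"
  proof (rule tendsto_upperbound)
    show "((\<lambda>h. f x0 / (?a h + ?b h) - h) \<longlongrightarrow> f x0) (at_right 0)"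
      using tendsto_diff[OF tendsto_divide[OF tendsto_const lim_s, of "f x0"] tendsto_ident_at] by simp
    show "\<forall>\<^sub>F h in at_right 0. f x0 / (?a h + ?b h) - h \<le> r"
      using h pos
    proof eventually_elim
      case (elim h)
      from mesh_bounds(2)[OF this] show ?case using r by (simp add: ennreal_le_iff)
    qed
  qed simp
  ultimately show ?thesis using r by simp
qed

end

section \<open>The star\<close>

definition balance_weight :: "opinion \<Rightarrow> real" where
  "balance_weight c = (case c of St0 \<Rightarrow> 1 | St1 \<Rightarrow> - 1 | _ \<Rightarrow> 0)"

definition ones :: "nat \<Rightarrow> config \<Rightarrow> nat" where
  "ones n x = card {i\<in>{1..n}. x i = St1}"

text \<open>Every rule preserves the difference between the numbers of nodes in state 0 and in state 1.\<close>

definition balanced :: "nat \<Rightarrow> real \<Rightarrow> config set" where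
  "balanced n d = {x. (\<Sum>i\<in>{1..n}. balance_weight (x i)) = d}"

definition depleted :: "nat \<Rightarrow> config set" where
  "depleted n = {x. \<forall>i\<in>{1..n}. x i \<noteq> St1}"

lemma sum_contact:
  fixes \<phi> :: "opinion \<Rightarrow> real"
  assumes "i \<in> S" "j \<in> S" "i \<noteq> j" "finite S"
  shows "(\<Sum>k\<in>S. \<phi> (contact i j x k)) = (\<Sum>k\<in>S. \<phi> (x k)) - \<phi> (x i) - \<phi> (x j)
    + \<phi> (fst (interact (x i) (x j))) + \<phi> (snd (interact (x i) (x j)))"
proof -
  have split: "(\<Sum>k\<in>S. \<psi> k) = \<psi> i + \<psi> j + (\<Sum>k\<in>S - {i} - {j}. \<psi> k)" for \<psi> :: "nat \<Rightarrow> real"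
    using assms by (simp add: sum.remove[of S i] sum.remove[of "S - {i}" j])
  have "(\<Sum>k\<in>S - {i} - {j}. \<phi> (contact i j x k)) = (\<Sum>k\<in>S - {i} - {j}. \<phi> (x k))"
    by (rule sum.cong) (auto simp: contact_def)
  then show ?thesis
    unfolding split[of "\<lambda>k. \<phi> (contact i j x k)"] split[of "\<lambda>k. \<phi> (x k)"]
    using assms by (simp add: contact_def)
qed

lemma balance_interact:
  "balance_weight (fst (interact a b)) + balance_weight (snd (interact a b)) = balance_weight a + balance_weight b"
  by (cases a; cases b) (simp_all add: interact_def balance_weight_def)

lemma balanced_closed: "contact_closed n (balanced n d)"
  unfolding contact_closed_def
proof safe
  fix x i j assume x: "x \<in> balanced n d" and "(i, j) \<in> node_pairs n"
  then have "i \<in> {1..n}" "j \<in> {1..n}" "i \<noteq> j" by (auto simp: node_pairs_def)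
  with x balance_interact[of "x i" "x j"] show "contact i j x \<in> balanced n d"
    by (simp add: balanced_def sum_contact)
qed

lemma interact_not_St1: "a \<noteq> St1 \<Longrightarrow> b \<noteq> St1 \<Longrightarrow> fst (interact a b) \<noteq> St1 \<and> snd (interact a b) \<noteq> St1"
  by (cases a; cases b) (simp_all add: interact_def)

lemma depleted_closed: "contact_closed n (depleted n)"
  using interact_not_St1
  by (auto simp: contact_closed_def depleted_def contact_def node_pairs_def)

lemma depleted_iff: "x \<in> depleted n \<longleftrightarrow> ones n x = 0"
  by (auto simp: depleted_def ones_def)

lemma real_card_eq_sum: "finite S \<Longrightarrow> real (card {i\<in>S. P i}) = (\<Sum>i\<in>S. of_bool (P i))"
  by (simp add: of_bool_def sum.inter_filter[symmetric])

lemma sum_balance_weight: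
  "(\<Sum>i\<in>{1..n}. balance_weight (x i)) = real (card {i\<in>{1..n}. x i = St0}) - real (ones n x)"
proof -
  have "balance_weight c = of_bool (c = St0) - of_bool (c = St1)" for c
    by (cases c) (simp_all add: balance_weight_def)
  then show ?thesis
    unfolding ones_def real_card_eq_sum[OF finite_atLeastAtMost]
    by (simp only: sum_subtractf)
qed

lemma balanced_iff:
  "x \<in> balanced n d \<longleftrightarrow> real (card {i\<in>{1..n}. x i = St0}) - real (ones n x) = d"
  by (simp only: balanced_def mem_Collect_eq sum_balance_weight)

text \<open>The rules move the states 0 and 1 around, except that a contact of 0 with 1 destroys one of each.\<close>

lemma ones_contact:
  assumes "i \<in> {1..n}" "j \<in> {1..n}" "i \<noteq> j"
  shows "ones n (contact i j x) = (if {x i, x j} = {St0, St1} then ones n x - 1 else ones n x)"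
proof -
  have "real (ones n (contact i j x)) = real (ones n x) - of_bool (x i = St1) - of_bool (x j = St1)
    + of_bool (fst (interact (x i) (x j)) = St1) + of_bool (snd (interact (x i) (x j)) = St1)"
    unfolding ones_def real_card_eq_sum[OF finite_atLeastAtMost]
    by (rule sum_contact[where \<phi>="\<lambda>c. of_bool (c = St1)"]) (use assms in auto)
  also have "\<dots> = real (ones n x) - of_bool ({x i, x j} = {St0, St1})"
    by (cases "x i"; cases "x j") (simp_all add: interact_def doubleton_eq_iff)
  finally have eq: "real (ones n (contact i j x)) = real (ones n x) - of_bool ({x i, x j} = {St0, St1})" .
  show ?thesis
  proof (cases "{x i, x j} = {St0, St1}")
    case True
    with eq have "real (ones n (contact i j x)) = real (ones n x) - 1" by simp
    then have "ones n (contact i j x) = ones n x - 1" by linarith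
    with True show ?thesis by simp
  next
    case False
    with eq have "real (ones n (contact i j x)) = real (ones n x)" by simp
    with False show ?thesis by (simp only: if_False of_nat_eq_iff)
  qed
qed

text \<open>As far as the nodes in state 1 are concerned, the states \<open>e\<^sub>0\<close> and \<open>e\<^sub>1\<close> are equivalent; hence a
function of the state of a leaf averages to an expression in the numbers of 0s and 1s only.\<close>

lemma sum_by_opinion:
  fixes \<phi> :: "opinion \<Rightarrow> real"
  assumes "finite S" "\<phi> Ste1 = \<phi> Ste0"
  shows "(\<Sum>i\<in>S. \<phi> (x i)) = real (card {i\<in>S. x i = St0}) * \<phi> St0 + real (card {i\<in>S. x i = St1}) * \<phi> St1
    + (real (card S) - real (card {i\<in>S. x i = St0}) - real (card {i\<in>S. x i = St1})) * \<phi> Ste0"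
proof -
  have "\<phi> c = of_bool (c = St0) * (\<phi> St0 - \<phi> Ste0) + of_bool (c = St1) * (\<phi> St1 - \<phi> Ste0) + \<phi> Ste0" for c
    using assms by (cases c) simp_all
  then have "(\<Sum>i\<in>S. \<phi> (x i)) = (\<Sum>i\<in>S. of_bool (x i = St0) * (\<phi> St0 - \<phi> Ste0)
      + of_bool (x i = St1) * (\<phi> St1 - \<phi> Ste0) + \<phi> Ste0)"
    by metis
  also have "\<dots> = real (card {i\<in>S. x i = St0}) * (\<phi> St0 - \<phi> Ste0)
      + real (card {i\<in>S. x i = St1}) * (\<phi> St1 - \<phi> Ste0) + real (card S) * \<phi> Ste0"
    by (simp only: sum.distrib sum_distrib_right[symmetric] sum_constant real_card_eq_sum[OF assms(1)])
  finally show ?thesis by (simp add: algebra_simps)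
qed

lemma sum_star_rates:
  assumes "2 \<le> n"
  shows "(\<Sum>e\<in>node_pairs n. case_prod (star_rates n) e * G e) = (\<Sum>j\<in>{2..n}. G (1, j)) / (real n - 1)"
proof -
  have "(\<Sum>e\<in>node_pairs n. case_prod (star_rates n) e * G e) =
      (\<Sum>e\<in>(\<lambda>j. (1, j)) ` {2..n}. G e / (real n - 1))"
    proof (rule sum.mono_neutral_cong_right[OF finite_node_pairs])
  qed (use assms in \<open>auto simp: node_pairs_def star_rates_def\<close>)
  also have "\<dots> = (\<Sum>j\<in>{2..n}. G (1, j) / (real n - 1))"
    by (subst sum.reindex) (auto simp: inj_on_def)
  finally show ?thesis by (simp add: sum_divide_distrib)
qed

text \<open>Consider \<open>b\<close> nodes in state 1 and \<open>a = b + d\<close> nodes in state 0, and let \<open>\<tau>\<close> be the mean time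
until the next annihilation, starting with a hub in state \<open>e\<^sub>0\<close> or \<open>e\<^sub>1\<close>.  Leaves contact the hub
at total rate 1, each being chosen with probability \<open>1 / (n - 1)\<close>.  The hub leaves its state after
mean time \<open>(n - 1) / (a + b)\<close>, adopting 0 or 1 with odds \<open>a : b\<close>.  A hub in state 0 then waits for
mean time \<open>(n - 1) / (n - a)\<close>, after which it either meets one of the \<open>b\<close> leaves in state 1, with
probability \<open>b / (n - a)\<close>, or returns to \<open>e\<^sub>0\<close> and everything starts afresh; a hub in state 1
behaves symmetrically.  Solving the resulting linear equation for \<open>\<tau>\<close> gives the formula below.\<close>

definition level_time :: "real \<Rightarrow> real \<Rightarrow> real \<Rightarrow> real" where
  "level_time n d b = (n - 1) * (n\<^sup>2 - b * (b + d)) / (b * (b + d) * (2 * n - d - 2 * b))"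

definition levels_time :: "real \<Rightarrow> real \<Rightarrow> nat \<Rightarrow> real" where
  "levels_time n d b = (\<Sum>i=1..b. level_time n d (real i))"

definition mean_time :: "real \<Rightarrow> real \<Rightarrow> opinion \<Rightarrow> nat \<Rightarrow> real" where
  "mean_time n d h b = (if b = 0 then 0 else case h of
      St0 \<Rightarrow> (n - 1 + b * levels_time n d (b - 1) + (n - d - 2 * b) * levels_time n d b) / (n - (b + d))
    | St1 \<Rightarrow> (n - 1 + (b + d) * levels_time n d (b - 1) + (n - d - 2 * b) * levels_time n d b) / (n - b)
    | _ \<Rightarrow> levels_time n d b)"

lemma levels_time_step: "0 < b \<Longrightarrow> levels_time n d b = levels_time n d (b - 1) + level_time n d b"
  by (cases b) (simp_all add: levels_time_def)

lemma mean_time_e: "mean_time n d Ste0 b = levels_time n d b" "mean_time n d Ste1 b = levels_time n d b"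
  by (simp_all add: mean_time_def levels_time_def)

lemma first_step_St0:
  assumes "0 < b" "0 < d" "d + 2 * real b \<le> n"
  shows "b * (mean_time n d St0 b - levels_time n d (b - 1))
    + (n - d - 2 * b) * (mean_time n d St0 b - levels_time n d b) = n - 1"
proof -
  have "0 < real b" using assms by simp
  then have "0 < n - (b + d)" using assms by linarith
  then have "(n - (b + d)) * mean_time n d St0 b = n - 1 + b * levels_time n d (b - 1) + (n - d - 2 * b) * levels_time n d b"
    using assms by (simp add: mean_time_def)
  then show ?thesis by (simp add: algebra_simps)
qed

lemma first_step_St1:
  assumes "0 < b" "0 < d" "d + 2 * real b \<le> n"
  shows "(b + d) * (mean_time n d St1 b - levels_time n d (b - 1))
    + (n - d - 2 * b) * (mean_time n d St1 b - levels_time n d b) = n - 1"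
proof -
  have "0 < real b" using assms by simp
  then have "0 < n - b" using assms by linarith
  then have "(n - b) * mean_time n d St1 b = n - 1 + (b + d) * levels_time n d (b - 1) + (n - d - 2 * b) * levels_time n d b"
    using assms by (simp add: mean_time_def)
  then show ?thesis by (simp add: algebra_simps)
qed

text \<open>By the first-step equations for a hub in state 0 or 1, the differences on the left are
\<open>(b \<tau> - (n - 1)) / (n - a)\<close> and \<open>(a \<tau> - (n - 1)) / (n - b)\<close> with \<open>\<tau>\<close> the level time; the equation
is then the one that defines \<open>\<tau>\<close>.\<close>

lemma first_step_e:
  assumes "0 < b" "0 < d" "d + 2 * real b \<le> n"
  shows "(b + d) * (levels_time n d b - mean_time n d St0 b) + b * (levels_time n d b - mean_time n d St1 b) = n - 1"
proof -
  define a where "a = b + d"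
  define G where "G = levels_time n d b"
  \<comment> \<open>in these letters the level time is \<open>(n - 1) (n\<^sup>2 - a b) / (a b (2 n - a - b))\<close>\<close>
  define \<tau> where "\<tau> = level_time n d b"
  have b: "0 < real b" using assms by simp
  have pos: "0 < a" "0 < n - a" "0 < n - b" "0 < 2 * n - a - b" using assms b unfolding a_def by linarith+
  have G1: "levels_time n d (b - 1) = G - \<tau>" using levels_time_step[OF assms(1), of n d] by (simp add: G_def \<tau>_def)
  have \<tau>: "\<tau> * (a * b * (2 * n - a - b)) = (n - 1) * (n\<^sup>2 - a * b)"
  proof -
    have "\<tau> = (n - 1) * (n\<^sup>2 - a * b) / (a * b * (2 * n - a - b))"
      by (simp add: \<tau>_def level_time_def a_def algebra_simps)
    moreover have "a * b * (2 * n - a - b) \<noteq> 0" using pos b by simp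
    ultimately show ?thesis by simp
  qed
  have 0: "(n - a) * (G - mean_time n d St0 b) = b * \<tau> - (n - 1)"
    using first_step_St0[OF assms] unfolding G1 a_def G_def[symmetric] by (simp add: algebra_simps)
  have 1: "(n - b) * (G - mean_time n d St1 b) = a * \<tau> - (n - 1)"
    using first_step_St1[OF assms] unfolding G1 a_def G_def[symmetric] by (simp add: algebra_simps)
  have "(n - a) * (n - b) * (a * (G - mean_time n d St0 b) + b * (G - mean_time n d St1 b)) =
      a * (n - b) * ((n - a) * (G - mean_time n d St0 b)) + b * (n - a) * ((n - b) * (G - mean_time n d St1 b))"
    by (simp add: algebra_simps)
  also have "\<dots> = \<tau> * (a * b * (2 * n - a - b)) - (n - 1) * (a * (n - b) + b * (n - a))"
    unfolding 0 1 by (simp add: algebra_simps)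
  also have "\<dots> = (n - a) * (n - b) * (n - 1)"
    unfolding \<tau> by (simp add: algebra_simps power2_eq_square)
  finally show ?thesis using pos unfolding a_def G_def by simp
qed

lemma level_time_nonneg:
  assumes "0 < b" "0 \<le> d" "d + 2 * b \<le> n" "1 \<le> n"
  shows "0 \<le> level_time n d b"
proof -
  have "b * (b + d) \<le> n * n" using assms by (intro mult_mono) auto
  moreover have "0 < 2 * n - d - 2 * b" using assms by linarith
  ultimately show ?thesis
    unfolding level_time_def using assms
    by (intro divide_nonneg_nonneg mult_nonneg_nonneg) (auto simp: power2_eq_square)
qed

lemma levels_time_nonneg:
  assumes "0 \<le> d" "d + 2 * real b \<le> n" "1 \<le> n"
  shows "0 \<le> levels_time n d b"
  unfolding levels_time_def by (intro sum_nonneg level_time_nonneg) (use assms in auto)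

lemma mean_time_nonneg:
  assumes "0 \<le> d" "d + 2 * real b \<le> n" "1 \<le> n"
  shows "0 \<le> mean_time n d h b"
proof -
  have "0 \<le> levels_time n d b" "0 \<le> levels_time n d (b - 1)"
    using assms by (auto intro!: levels_time_nonneg)
  then show ?thesis
    unfolding mean_time_def using assms
    by (auto split: opinion.split intro!: divide_nonneg_nonneg add_nonneg_nonneg mult_nonneg_nonneg)
qed

lemma balanced_bound:
  assumes "x \<in> balanced n d"
  shows "d + 2 * real (ones n x) \<le> real n"
proof -
  let ?S = "\<lambda>c. {i\<in>{1..n}. x i = c}"
  have "card (?S St0) + card (?S St1) = card (?S St0 \<union> ?S St1)"
    by (rule card_Un_disjoint[symmetric]) auto
  also have "\<dots> \<le> card {1..n}" by (rule card_mono) auto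
  finally have "card (?S St0) + ones n x \<le> n" by (simp add: ones_def)
  then have "real (card (?S St0)) + real (ones n x) \<le> real n" by linarith
  with assms show ?thesis by (simp add: balanced_iff)
qed

lemma card_leaves:
  fixes n :: nat
  assumes "1 \<le> n"
  shows "real (card {j\<in>{2..n}. x j = c}) = real (card {i\<in>{1..n}. x i = c}) - of_bool (x 1 = c)"
proof -
  have eq: "{1..n} = insert 1 {2..n}" using assms by auto
  have "real (card {i\<in>{1..n}. x i = c}) = (\<Sum>i\<in>insert 1 {2..n}. of_bool (x i = c))"
    by (subst real_card_eq_sum) (simp_all only: eq finite_insert finite_atLeastAtMost)
  moreover have "real (card {j\<in>{2..n}. x j = c}) = (\<Sum>j\<in>{2..n}. of_bool (x j = c))"
    by (rule real_card_eq_sum) simp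
  ultimately show ?thesis by (simp only: sum.insert finite_atLeastAtMost) simp
qed

lemma star_generator:
  assumes n: "2 \<le> n" and d: "0 < d" and x: "x \<in> balanced n d" "x \<notin> depleted n"
  shows "(\<Sum>e\<in>node_pairs n. case_prod (star_rates n) e *
    (mean_time n d (x 1) (ones n x) - mean_time n d (case_prod contact e x 1) (ones n (case_prod contact e x)))) = 1"
proof -
  define b where "b = ones n x"
  define h where "h = x 1"
  define \<phi> where "\<phi> c = mean_time n d h b - mean_time n d (fst (interact h c)) (if {h, c} = {St0, St1} then b - 1 else b)" for c
  have b: "0 < b" using x by (simp add: depleted_iff b_def)
  have bd: "d + 2 * real b \<le> real n" using balanced_bound[OF x(1)] by (simp add: b_def)
  have zeros: "real (card {i\<in>{1..n}. x i = St0}) = b + d"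
    using x(1) by (simp add: balanced_iff b_def)
  have ones: "real (card {i\<in>{1..n}. x i = St1}) = b" by (simp add: b_def ones_def)
  have "(\<Sum>e\<in>node_pairs n. case_prod (star_rates n) e *
    (mean_time n d (x 1) (ones n x) - mean_time n d (case_prod contact e x 1) (ones n (case_prod contact e x)))) =
    (\<Sum>j\<in>{2..n}. \<phi> (x j)) / (real n - 1)"
    unfolding sum_star_rates[OF n]
  proof (rule arg_cong[where f="\<lambda>s. s / _"], rule sum.cong[OF refl])
    fix j assume "j \<in> {2..n}"
    then have j: "1 \<in> {1..n}" "j \<in> {1..n}" "1 \<noteq> j" using n by auto
    have "contact 1 j x 1 = fst (interact h (x j))" using j(3) by (simp add: contact_def h_def)
    with ones_contact[OF j, of x]
    show "mean_time n d (x 1) (ones n x) - mean_time n d (case_prod contact (1, j) x 1) (ones n (case_prod contact (1, j) x))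
      = \<phi> (x j)"
      unfolding \<phi>_def case_prod_conv by (simp only: b_def h_def)
  qed
  also have "(\<Sum>j\<in>{2..n}. \<phi> (x j)) = (b + d - of_bool (h = St0)) * \<phi> St0 + (real b - of_bool (h = St1)) * \<phi> St1
    + (real n - 1 - (b + d - of_bool (h = St0)) - (real b - of_bool (h = St1))) * \<phi> Ste0"
  proof -
    have e: "\<phi> Ste1 = \<phi> Ste0"
      by (cases h) (simp_all add: \<phi>_def interact_def mean_time_e doubleton_eq_iff)
    have n1: "1 \<le> n" using n by simp
    have "real (card {j\<in>{2..n}. x j = St0}) = b + d - of_bool (h = St0)"
      and "real (card {j\<in>{2..n}. x j = St1}) = real b - of_bool (h = St1)"
      by (simp_all only: card_leaves[OF n1] zeros ones h_def)
    moreover have "real (card {2..n}) = real n - 1" using n by simp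
    ultimately show ?thesis by (simp only: sum_by_opinion[where \<phi>=\<phi>, OF finite_atLeastAtMost e])
  qed
  also have "\<dots> = real n - 1"
  proof (cases h)
    case St0
    then show ?thesis using first_step_St0[OF b d bd]
      by (simp add: \<phi>_def interact_def mean_time_e doubleton_eq_iff algebra_simps)
  next
    case St1
    then show ?thesis using first_step_St1[OF b d bd]
      by (simp add: \<phi>_def interact_def mean_time_e doubleton_eq_iff algebra_simps)
  next
    case Ste0
    then show ?thesis using first_step_e[OF b d bd]
      by (simp add: \<phi>_def interact_def mean_time_e doubleton_eq_iff algebra_simps)
  next
    case Ste1
    then show ?thesis using first_step_e[OF b d bd]
      by (simp add: \<phi>_def interact_def mean_time_e doubleton_eq_iff algebra_simps)
  qed
  finally show ?thesis using n by simp
qed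

lemma expected_depletion_time:
  assumes n: "2 \<le> n" and ic: "interval_consensus M n (star_rates n) x0 N X"
    and d: "real (card {i\<in>{1..n}. x0 i = St0}) - real (ones n x0) = d" "0 < d"
  shows "(\<integral>\<^sup>+ \<omega>. depletion_time n (\<lambda>t. X t \<omega>) \<partial>M) = ennreal (mean_time n d (x0 1) (ones n x0))"
proof -
  let ?f = "\<lambda>x. mean_time n d (x 1) (ones n x)"
  have "prob_space M" using ic by (simp add: interval_consensus_def)
  then interpret prob_space M .
  interpret consensus_hitting M n "star_rates n" x0 N X "balanced n d" "depleted n" ?f
  proof unfold_locales
    show "x0 \<in> balanced n d" using d by (simp add: balanced_iff)
    show "0 \<le> ?f x" if "x \<in> balanced n d" for x
      using balanced_bound[OF that] n d by (intro mean_time_nonneg) auto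
    show "?f x = 0" if "x \<in> depleted n" for x
      using that by (simp add: depleted_iff mean_time_def)
  qed (use n ic d balanced_closed depleted_closed star_generator in auto)
  have "hitting_time \<omega> = depletion_time n (\<lambda>t. X t \<omega>)" for \<omega>
    unfolding hitting_time_def depletion_time_def by (simp add: depleted_def)
  with expected_hitting_time show ?thesis by simp
qed

section \<open>Asymptotics\<close>

text \<open>The product of \<open>b\<close> and the level time equals \<open>n - 1\<close> times a smooth function of \<open>b / n\<close> whose value
at 0 is \<open>c\<close>.  Its deviation is of order \<open>b / n\<close>, so that the errors remain bounded uniformly in the
level.\<close>

lemma level_time_asymp:
  fixes \<delta> n b :: real
  defines "c \<equiv> 1 / (\<delta> * (2 - \<delta>))"
  assumes \<delta>: "0 < \<delta>" "\<delta> < 1" and n: "1 \<le> n" and b: "0 < b" "\<delta> * n + 2 * b \<le> n"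
  shows "\<bar>level_time n (\<delta> * n) b - c * (n - 1) / b\<bar> \<le> 5 / \<delta>\<^sup>2"
proof -
  define d where "d = \<delta> * n"
  \<comment> \<open>\<open>r\<close> and \<open>d (2 n - d) = q n\<^sup>2\<close> differ by a multiple of \<open>b\<close>, which cancels the pole at 0\<close>
  define q where "q = \<delta> * (2 - \<delta>)"
  define r where "r = (b + d) * (2 * n - d - 2 * b)"
  define s where "s = 2 * d - q * (b + d) - (2 * n - d - 2 * b)"
  have d: "0 < d" "d + 2 * b \<le> n" using \<delta> n b by (simp_all add: d_def)
  have q: "\<delta> \<le> q" "q \<le> 1"
  proof -
    have "\<delta> * 1 \<le> \<delta> * (2 - \<delta>)" using \<delta> by (intro mult_left_mono) auto
    then show "\<delta> \<le> q" by (simp add: q_def)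
    have "0 \<le> (1 - \<delta>)\<^sup>2" by simp
    then show "q \<le> 1" by (simp add: q_def power2_eq_square algebra_simps)
  qed
  have q0: "0 < q" using q \<delta> by linarith
  have r: "d * n \<le> r" unfolding r_def using d b by (intro mult_mono) auto
  have r0: "0 < r" using r d n by (meson less_le_trans mult_pos_pos zero_less_one order.strict_trans2)
  have "level_time n d b - c * (n - 1) / b = (n - 1) * (q * (n\<^sup>2 - b * (b + d)) - r) / (b * r * q)"
  proof -
    have "level_time n d b = (n - 1) * (n\<^sup>2 - b * (b + d)) / (b * r)"
      by (simp add: level_time_def r_def mult.assoc)
    moreover have "(n - 1) * A / (b * r) - 1 / q * (n - 1) / b = (n - 1) * (q * A - r) / (b * r * q)" for A
      using b r0 q0 by (simp add: field_simps)
    ultimately show ?thesis unfolding c_def q_def[symmetric] by simp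
  qed
  also have "q * (n\<^sup>2 - b * (b + d)) - r = b * s"
    unfolding q_def r_def s_def d_def by (simp add: algebra_simps power2_eq_square)
  also have "(n - 1) * (b * s) / (b * r * q) = (n - 1) * s / (r * q)" using b by simp
  finally have eq: "level_time n d b - c * (n - 1) / b = (n - 1) * s / (r * q)" .
  have w: "q * (b + d) \<le> b + d" "0 \<le> q * (b + d)"
    using q q0 b d mult_right_mono[of q 1 "b + d"] by auto
  have "\<bar>2 * d - w - (2 * n - d - 2 * b)\<bar> \<le> 5 * n" if "w \<le> b + d" "0 \<le> w" for w
    using that b d n by linarith
  then have s: "\<bar>s\<bar> \<le> 5 * n" unfolding s_def using w by blast
  have "\<bar>(n - 1) * s / (r * q)\<bar> = (n - 1) * \<bar>s\<bar> / (r * q)"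
    using n r0 q0 by (simp add: abs_mult abs_divide)
  also have "\<dots> \<le> n * (5 * n) / (d * n * \<delta>)"
    using n s r q \<delta> d r0 q0 by (intro frac_le mult_mono) auto
  also have "\<dots> = 5 / \<delta>\<^sup>2" using n \<delta> by (simp add: d_def power2_eq_square)
  finally show ?thesis using eq by (simp add: d_def)
qed

lemma harm_ln_bounds:
  assumes "0 < b" shows "ln (real b) \<le> harm b" "harm b \<le> ln (real b) + 1"
proof -
  have "ln (real b) \<le> ln (real b + 1)" using assms by simp
  then show "ln (real b) \<le> harm b" using ln_le_harm[of b] by linarith
  show "harm b \<le> ln (real b) + 1"
    using assms
  proof (induction b rule: nat_induct_non_zero)
    case 1
    show ?case by (simp add: harm_def)
  next
    case (Suc b)
    have "inverse (real (Suc b)) \<le> ln (real (Suc b)) - ln (real b)"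
    proof -
      have "ln (real b / real (Suc b)) \<le> real b / real (Suc b) - 1"
        using Suc by (intro ln_le_minus_one) auto
      also have "\<dots> = - inverse (real (Suc b))" by (simp add: field_simps)
      finally show ?thesis using Suc by (simp add: ln_div)
    qed
    with Suc show ?case by (simp add: harm_Suc)
  qed
qed

lemma levels_time_asymp:
  fixes \<delta> n :: real
  defines "c \<equiv> 1 / (\<delta> * (2 - \<delta>))"
  assumes \<delta>: "0 < \<delta>" "\<delta> < 1" and n: "1 \<le> n" and b: "0 < b" "2 * real b = (1 - \<delta>) * n"
  shows "\<bar>levels_time n (\<delta> * n) b - c * (n * ln n)\<bar> \<le> (5 / \<delta>\<^sup>2 + c * (2 - ln ((1 - \<delta>) / 2))) * n"
proof -
  have c: "0 < c" using \<delta> by (simp add: c_def)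
  have bn: "real b \<le> n" "\<delta> * n + 2 * real b = n"
  proof -
    show e: "\<delta> * n + 2 * real b = n" using b by (simp add: algebra_simps)
    have "0 \<le> \<delta> * n" using \<delta> n by simp
    then show "real b \<le> n" using e b by linarith
  qed
  have "levels_time n (\<delta> * n) b - c * (n - 1) * harm b = (\<Sum>i=1..b. level_time n (\<delta> * n) (real i) - c * (n - 1) / real i)"
    by (simp add: levels_time_def harm_def sum_subtractf sum_distrib_left divide_inverse)
  also have "\<bar>\<dots>\<bar> \<le> (\<Sum>i=1..b. 5 / \<delta>\<^sup>2)"
    by (rule order.trans[OF sum_abs sum_mono])
       (use \<delta> n bn in \<open>auto intro!: level_time_asymp[of \<delta>, folded c_def]\<close>)
  also have "\<dots> \<le> 5 / \<delta>\<^sup>2 * n" using bn \<delta> by (simp add: field_simps)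
  finally have 1: "\<bar>levels_time n (\<delta> * n) b - c * (n - 1) * harm b\<bar> \<le> 5 / \<delta>\<^sup>2 * n" .
  have lnb: "ln (real b) = ln n + ln ((1 - \<delta>) / 2)"
  proof -
    have "n * ((1 - \<delta>) / 2) = (1 - \<delta>) * n / 2" by simp
    then have "real b = n * ((1 - \<delta>) / 2)" using b(2) by linarith
    moreover have "ln (n * ((1 - \<delta>) / 2)) = ln n + ln ((1 - \<delta>) / 2)"
      using n \<delta> by (intro ln_mult_pos) auto
    ultimately show ?thesis by (simp only:)
  qed
  have "ln ((1 - \<delta>) / 2) \<le> 0" using \<delta> by (intro ln_le_zero_iff[THEN iffD2]) auto
  then have h: "\<bar>harm b - ln n\<bar> \<le> 1 - ln ((1 - \<delta>) / 2)"
    using harm_ln_bounds[OF b(1)] lnb by (auto simp: abs_le_iff)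
  have hb: "harm b \<le> n"
  proof -
    have "harm b \<le> (\<Sum>k=1..b. 1 :: real)" unfolding harm_def by (intro sum_mono) (auto simp: field_simps)
    with bn show ?thesis by simp
  qed
  have "(n - 1) * harm b - n * ln n = n * (harm b - ln n) - harm b" by (simp add: algebra_simps)
  also have "\<bar>\<dots>\<bar> \<le> n * \<bar>harm b - ln n\<bar> + harm b"
    using n harm_nonneg[of b, where 'a=real] by (intro order.trans[OF abs_triangle_ineq4]) (simp add: abs_mult)
  also have "\<dots> \<le> n * (1 - ln ((1 - \<delta>) / 2)) + n"
    using h hb n by (intro add_mono mult_left_mono) auto
  finally have 2: "c * \<bar>(n - 1) * harm b - n * ln n\<bar> \<le> c * (n * (1 - ln ((1 - \<delta>) / 2)) + n)"
    using c by (intro mult_left_mono) auto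
  have "levels_time n (\<delta> * n) b - c * (n * ln n) =
      (levels_time n (\<delta> * n) b - c * (n - 1) * harm b) + c * ((n - 1) * harm b - n * ln n)"
    by (simp add: algebra_simps)
  also have "\<bar>\<dots>\<bar> \<le> 5 / \<delta>\<^sup>2 * n + c * \<bar>(n - 1) * harm b - n * ln n\<bar>"
    using 1 c by (intro order.trans[OF abs_triangle_ineq]) (simp add: abs_mult)
  also have "\<dots> \<le> (5 / \<delta>\<^sup>2 + c * (2 - ln ((1 - \<delta>) / 2))) * n"
    using 2 by (simp add: algebra_simps)
  finally show ?thesis .
qed

text \<open>When all nodes are in state 0 or 1, the hub waits for a mean time of at most \<open>2 / (1 - \<delta>)\<close> for a
leaf of the opposite state.  Replacing the first level by this wait changes the mean by a
bounded amount only, whatever the hub's state.\<close>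

lemma mean_time_near_levels_time:
  fixes \<delta> n :: real
  assumes \<delta>: "0 < \<delta>" "\<delta> < 1" and n: "1 \<le> n" and b: "0 < b" "2 * real b = (1 - \<delta>) * n"
  shows "\<bar>mean_time n (\<delta> * n) h b - levels_time n (\<delta> * n) b\<bar> \<le> 8 / (1 - \<delta>)"
proof -
  define d where "d = \<delta> * n"
  have d: "d + 2 * real b = n" "0 < d" using b \<delta> n by (simp_all add: d_def algebra_simps)
  have bpos: "0 < real b" using b by simp
  have q: "(n - 1) / real b \<le> 2 / (1 - \<delta>)" "0 \<le> (n - 1) / real b" "(n - 1) / (real b + d) \<le> 2 / (1 - \<delta>)"
    "0 \<le> (n - 1) / (real b + d)"
  proof -
    have "real b = (1 - \<delta>) * n / 2" using b by simp
    then have e: "n / real b = 2 / (1 - \<delta>)" using n \<delta> by (simp only:) (simp add: field_simps)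
    have "(n - 1) / real b \<le> n / real b" using bpos by (intro divide_right_mono) auto
    then show "(n - 1) / real b \<le> 2 / (1 - \<delta>)" using e by simp
    moreover have "(n - 1) / (real b + d) \<le> (n - 1) / real b" using bpos d n by (intro divide_left_mono) auto
    ultimately show "(n - 1) / (real b + d) \<le> 2 / (1 - \<delta>)" by linarith
  qed (use n bpos d in auto)
  have \<tau>: "0 \<le> level_time n d b" "level_time n d b \<le> 6 / (1 - \<delta>)"
  proof -
    show "0 \<le> level_time n d b" using bpos d n by (intro level_time_nonneg) auto
    have "level_time n d b = (n - 1) * (n\<^sup>2 - b * (b + d)) / (b * (b + d) * n)"
      unfolding level_time_def using d(1) by (intro arg_cong2[where f="(/)"]) auto
    also have "\<dots> \<le> (n - 1) * n\<^sup>2 / (b * (b + d) * n)"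
      using bpos d n by (intro divide_right_mono mult_left_mono) auto
    also have "\<dots> = (n - 1) / b * (n / (b + d))" using n by (simp add: power2_eq_square)
    also have "\<dots> \<le> 2 / (1 - \<delta>) * 2"
    proof (intro mult_mono q)
      show "n / (b + d) \<le> 2" using d bpos by (simp add: field_simps)
    qed (use \<delta> n bpos d in auto)
    also have "\<dots> \<le> 6 / (1 - \<delta>)" using \<delta> by (simp add: divide_right_mono)
    finally show "level_time n d b \<le> 6 / (1 - \<delta>)" .
  qed
  have lev: "levels_time n d b = levels_time n d (b - 1) + level_time n d b" using b by (intro levels_time_step)
  have n0: "n - d - 2 * real b = 0" "n - (real b + d) = b" "n - real b = b + d" using d by auto
  have "mean_time n d St0 b = (n - 1) / b + levels_time n d (b - 1)"
    unfolding mean_time_def n0 using bpos by (simp add: add_divide_distrib)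
  moreover have "mean_time n d St1 b = (n - 1) / (b + d) + levels_time n d (b - 1)"
    unfolding mean_time_def n0 using bpos d by (simp add: add_divide_distrib)
  moreover have "8 / (1 - \<delta>) = 2 / (1 - \<delta>) + 6 / (1 - \<delta>)" by (simp add: add_divide_distrib[symmetric])
  moreover have "0 < 8 / (1 - \<delta>)" using \<delta> by simp
  ultimately have "\<bar>mean_time n d h b - levels_time n d b\<bar> \<le> 8 / (1 - \<delta>)"
    using q \<tau> lev by (cases h) (auto simp: mean_time_e abs_le_iff)
  then show ?thesis by (simp add: d_def)
qed

theorem proposition2:
  fixes \<alpha> :: real
    and M :: "nat \<Rightarrow> 'a measure"
    and x0 :: "nat \<Rightarrow> config"
    and N :: "nat \<Rightarrow> nat \<times> nat \<Rightarrow> real \<Rightarrow> 'a \<Rightarrow> nat"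
    and X :: "nat \<Rightarrow> real \<Rightarrow> 'a \<Rightarrow> config"
    and ET1 :: "nat \<Rightarrow> ennreal"
  assumes "1 / 2 < \<alpha>" and "\<alpha> < 1"
    and "\<And>n. n \<ge> 2 \<Longrightarrow> \<alpha> * real n \<in> \<int> \<Longrightarrow>
           interval_consensus (M n) n (star_rates n) (x0 n) (N n) (X n)"
    and "\<And>n. n \<ge> 2 \<Longrightarrow> \<alpha> * real n \<in> \<int> \<Longrightarrow>
           real (card {i \<in> {1..n}. x0 n i = St0}) = \<alpha> * real n"
    and "\<And>n. n \<ge> 2 \<Longrightarrow> \<alpha> * real n \<in> \<int> \<Longrightarrow>
           real (card {i \<in> {1..n}. x0 n i = St1}) = (1 - \<alpha>) * real n"
  defines "ET1 \<equiv> \<lambda>n. \<integral>\<^sup>+ \<omega>. depletion_time n (\<lambda>t. X n t \<omega>) \<partial>M n"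
  shows "(\<forall>\<^sub>F n in sequentially. \<alpha> * real n \<in> \<int> \<longrightarrow> ET1 n < \<infinity>) \<and>
         (\<lambda>n. enn2real (ET1 n) - 1 / ((2 * \<alpha> - 1) * (3 - 2 * \<alpha>)) * (real n * ln (real n)))
           \<in> O[inf sequentially (principal {n. \<alpha> * real n \<in> \<int>})](\<lambda>n. real n)"
proof -
  define \<delta> where "\<delta> = 2 * \<alpha> - 1"
  define c where "c = 1 / (\<delta> * (2 - \<delta>))"
  define K where "K = 8 / (1 - \<delta>) + (5 / \<delta>\<^sup>2 + c * (2 - ln ((1 - \<delta>) / 2)))"
  have \<delta>: "0 < \<delta>" "\<delta> < 1" using assms(1,2) by (simp_all add: \<delta>_def)
  have c: "1 / ((2 * \<alpha> - 1) * (3 - 2 * \<alpha>)) = c" by (simp add: c_def \<delta>_def)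
  have ET: "ET1 n = ennreal (mean_time n (\<delta> * n) (x0 n 1) (ones n (x0 n)))"
    and est: "\<bar>mean_time n (\<delta> * n) (x0 n 1) (ones n (x0 n)) - c * (real n * ln (real n))\<bar> \<le> K * real n"
    and nonneg: "0 \<le> mean_time n (\<delta> * n) (x0 n 1) (ones n (x0 n))"
    if n: "2 \<le> n" and int: "\<alpha> * real n \<in> \<int>" for n
  proof -
    let ?b = "ones n (x0 n)"
    have b: "real ?b = (1 - \<alpha>) * real n" unfolding ones_def by (rule assms(5)[OF n int])
    have b2: "2 * real ?b = (1 - \<delta>) * real n" using b by (simp add: \<delta>_def)
    have "0 < (1 - \<alpha>) * real n" using assms(2) n by simp
    then have b0: "0 < ?b" using b by (metis of_nat_0_less_iff)
    have n1: "1 \<le> real n" using n by simp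
    show "ET1 n = ennreal (mean_time n (\<delta> * n) (x0 n 1) ?b)"
      unfolding ET1_def
      using expected_depletion_time[OF n assms(3)[OF n int]] assms(4)[OF n int] b \<delta> n
      by (simp add: \<delta>_def algebra_simps)
    show "0 \<le> mean_time n (\<delta> * n) (x0 n 1) ?b"
      using \<delta> b2 n1 by (intro mean_time_nonneg) (auto simp: algebra_simps)
    have "0 \<le> 8 / (1 - \<delta>)" using \<delta> by simp
    then have "8 / (1 - \<delta>) \<le> 8 / (1 - \<delta>) * real n" using mult_left_mono[OF n1, of "8 / (1 - \<delta>)"] by simp
    with mean_time_near_levels_time[OF \<delta> n1 b0 b2, of "x0 n 1"] levels_time_asymp[OF \<delta> n1 b0 b2]
    show "\<bar>mean_time n (\<delta> * n) (x0 n 1) ?b - c * (real n * ln (real n))\<bar> \<le> K * real n"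
      unfolding K_def c_def[symmetric] distrib_right by linarith
  qed
  have "\<forall>\<^sub>F n in sequentially. \<alpha> * real n \<in> \<int> \<longrightarrow> ET1 n < \<infinity>"
    using eventually_ge_at_top[of 2] by eventually_elim (simp add: ET)
  moreover have "(\<lambda>n. enn2real (ET1 n) - c * (real n * ln (real n)))
      \<in> O[inf sequentially (principal {n. \<alpha> * real n \<in> \<int>})](\<lambda>n. real n)"
  proof (rule bigoI)
    show "\<forall>\<^sub>F n in inf sequentially (principal {n. \<alpha> * real n \<in> \<int>}).
        norm (enn2real (ET1 n) - c * (real n * ln (real n))) \<le> K * norm (real n)"
      unfolding eventually_inf_principal using eventually_ge_at_top[of 2]
      by eventually_elim (use est nonneg in \<open>simp add: ET\<close>)
  qed
  ultimately show ?thesis unfolding c by blast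
qed

end
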